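(* Let $1<p<\infty$ and let $X_p$ be either the space $\ell_p$ or the space $L_p[0,1]$. Then the space $\mathcal L(X_p)$ has the uniform ball-covering property (UBCP) and $\operatorname{bc}(\mathcal L(X_p))=1$.
   Context: All Banach spaces are real. $\mathcal L(X)$ is the Banach space of bounded linear operators from $X$ to $X$ with the operator norm. $S_Z$ is the unit sphere of $Z$ and $B(z,r)$ the open ball with center $z$ and radius $r>0$. A Banach space $Z$ has the UBCP if there are $r,\alpha>0$ and a countable collection of open balls $\{B(z_n,r_n)\}$ with $S_Z\subset\bigcup_nB(z_n,r_n)$, $\|z_n\|\ge r_n+\alpha$ for all $n$, and $\sup_n r_n\le r$. For $\alpha\in[-1,1)$, $Z$ has the $\alpha$-BCP if there is a countable collection of open balls $\{B(z_n,r_n)\}$, $r_n>0$, with $S_Z\subset\bigcup_n B(z_n,r_n)$ and $\|z_n\|\ge r_n+\alpha$ for all $n$. The ball-covering index is $\operatorname{bc}(Z):=\sup\{\alpha\in[-1,1): Z\text{ has the }\alpha\text{-BCP}\}$ ($=-1$ if this set is empty). *)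

theory Defs
  imports "HOL-Analysis.Analysis" "HOL-Library.Function_Algebras"
begin

text \<open>
  The spaces below depend on a real parameter \<open>p\<close>, so they cannot be types of class
  \<^class>\<open>real_normed_vector\<close>. A normed space is represented by a linear subspace of an
  ambient real vector space together with a norm that is only meaningful on that subspace.
\<close>

record 'a nspace =
  nscarrier :: "'a set"
  nsnorm :: "'a \<Rightarrow> real"

definition nsphere :: "'a::real_vector nspace \<Rightarrow> 'a set" where
  "nsphere Z = {x \<in> nscarrier Z. nsnorm Z x = 1}"

definition nsball :: "'a::real_vector nspace \<Rightarrow> 'a \<Rightarrow> real \<Rightarrow> 'a set" where
  "nsball Z z r = {x \<in> nscarrier Z. nsnorm Z (x - z) < r}"

text \<open>A countable collection of balls is given as a countable set of pairs (centre, radius).\<close>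

definition UBCP :: "'a::real_vector nspace \<Rightarrow> bool" where
  "UBCP Z \<longleftrightarrow> (\<exists>r>0. \<exists>\<alpha>>0. \<exists>C :: ('a \<times> real) set.
     countable C \<and>
     (\<forall>(z, s) \<in> C. z \<in> nscarrier Z \<and> s > 0 \<and> nsnorm Z z \<ge> s + \<alpha> \<and> s \<le> r) \<and>
     nsphere Z \<subseteq> (\<Union>(z, s) \<in> C. nsball Z z s))"

definition BCP :: "real \<Rightarrow> 'a::real_vector nspace \<Rightarrow> bool" where
  "BCP \<alpha> Z \<longleftrightarrow> (\<exists>C :: ('a \<times> real) set.
     countable C \<and>
     (\<forall>(z, s) \<in> C. z \<in> nscarrier Z \<and> s > 0 \<and> nsnorm Z z \<ge> s + \<alpha>) \<and>
     nsphere Z \<subseteq> (\<Union>(z, s) \<in> C. nsball Z z s))"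

definition bc :: "'a::real_vector nspace \<Rightarrow> real" where
  "bc Z = (if \<exists>\<alpha>\<in>{-1..<1}. BCP \<alpha> Z then Sup {\<alpha> \<in> {-1..<1}. BCP \<alpha> Z} else -1)"

instantiation "fun" :: (type, real_vector) real_vector
begin

definition scaleR_fun :: "real \<Rightarrow> ('a \<Rightarrow> 'b) \<Rightarrow> 'a \<Rightarrow> 'b" where
  "scaleR_fun c f = (\<lambda>x. c *\<^sub>R f x)"

instance
  by standard (auto simp: scaleR_fun_def fun_eq_iff scaleR_add_right scaleR_add_left)

end

text \<open>
  An operator on \<open>X\<close> is a function on the ambient type that vanishes outside the carrier; this
  makes equality of operators coincide with equality on the carrier and is
  preserved by the pointwise vector space operations.
\<close>

definition bounded_operators :: "'a::real_vector nspace \<Rightarrow> ('a \<Rightarrow> 'a) set" where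
  "bounded_operators X = {T.
     (\<forall>x. x \<notin> nscarrier X \<longrightarrow> T x = 0) \<and>
     (\<forall>x\<in>nscarrier X. T x \<in> nscarrier X) \<and>
     (\<forall>x\<in>nscarrier X. \<forall>y\<in>nscarrier X. T (x + y) = T x + T y) \<and>
     (\<forall>c. \<forall>x\<in>nscarrier X. T (c *\<^sub>R x) = c *\<^sub>R T x) \<and>
     (\<exists>K. \<forall>x\<in>nscarrier X. nsnorm X (T x) \<le> K * nsnorm X x)}"

definition operator_space :: "'a::real_vector nspace \<Rightarrow> ('a \<Rightarrow> 'a) nspace" where
  "operator_space X = \<lparr> nscarrier = bounded_operators X,
     nsnorm = (\<lambda>T. SUP x\<in>{x \<in> nscarrier X. nsnorm X x \<le> 1}. nsnorm X (T x)) \<rparr>"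

definition ell_p :: "real \<Rightarrow> (nat \<Rightarrow> real) nspace" where
  "ell_p p = \<lparr> nscarrier = {x. summable (\<lambda>n. \<bar>x n\<bar> powr p)},
     nsnorm = (\<lambda>x. (\<Sum>n. \<bar>x n\<bar> powr p) powr (1 / p)) \<rparr>"

text \<open>
  The ambient space for all \<open>L\<^sub>p[0,1]\<close>: Lebesgue measurable functions on the unit interval
  modulo equality almost everywhere (values outside the interval are irrelevant).
\<close>

definition ae_eq01 :: "(real \<Rightarrow> real) \<Rightarrow> (real \<Rightarrow> real) \<Rightarrow> bool" where
  "ae_eq01 f g \<longleftrightarrow> f \<in> borel_measurable (lebesgue_on {0..1}) \<and>
     g \<in> borel_measurable (lebesgue_on {0..1}) \<and> (AE x in lebesgue_on {0..1}. f x = g x)"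

quotient_type L0 = "real \<Rightarrow> real" / partial: ae_eq01
proof (rule part_equivpI)
  show "\<exists>x. ae_eq01 x x"
    by (rule exI[of _ "\<lambda>_. 0"]) (simp add: ae_eq01_def)
  show "symp ae_eq01"
    by (auto simp: symp_def ae_eq01_def)
  show "transp ae_eq01"
    unfolding transp_def ae_eq01_def by (auto elim: AE_mp)
qed

instantiation L0 :: real_vector
begin

lift_definition zero_L0 :: L0 is "\<lambda>_. 0"
  by (simp add: ae_eq01_def)

lift_definition plus_L0 :: "L0 \<Rightarrow> L0 \<Rightarrow> L0" is "\<lambda>f g x. f x + g x"
  unfolding ae_eq01_def by (auto elim: AE_mp)

lift_definition minus_L0 :: "L0 \<Rightarrow> L0 \<Rightarrow> L0" is "\<lambda>f g x. f x - g x"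
  unfolding ae_eq01_def by (auto elim: AE_mp)

lift_definition uminus_L0 :: "L0 \<Rightarrow> L0" is "\<lambda>f x. - f x"
  unfolding ae_eq01_def by (auto elim: AE_mp)

lift_definition scaleR_L0 :: "real \<Rightarrow> L0 \<Rightarrow> L0" is "\<lambda>c f x. c * f x"
  unfolding ae_eq01_def by (auto elim: AE_mp)

instance
  by standard (transfer; auto simp: ae_eq01_def algebra_simps)+

end

lift_definition p_integrable :: "real \<Rightarrow> L0 \<Rightarrow> bool" is
  "\<lambda>p f. integrable (lebesgue_on {0..1}) (\<lambda>x. \<bar>f x\<bar> powr p)"
  unfolding ae_eq01_def by (rule integrable_cong_AE) (auto elim: AE_mp)

lift_definition p_norm :: "real \<Rightarrow> L0 \<Rightarrow> real" is
  "\<lambda>p f. (LINT x|lebesgue_on {0..1}. \<bar>f x\<bar> powr p) powr (1 / p)"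
  unfolding ae_eq01_def by (intro arg_cong2[where f = "(powr)"] integral_cong_AE) (auto elim: AE_mp)

definition Lp01 :: "real \<Rightarrow> L0 nspace" where
  "Lp01 p = \<lparr> nscarrier = {f. p_integrable p f}, nsnorm = p_norm p \<rparr>"

end

theory Submission
  imports Defs
begin

text \<open>
  Let \<open>T\<close> be an operator of norm \<open>1\<close> on \<open>X\<close> and \<open>u\<close> a unit vector with \<open>\<parallel>T u\<parallel>\<close> close to \<open>1\<close>. If a norm-one
  functional \<open>\<phi>\<close> strongly exposes \<open>u\<close>, then for \<open>y\<close> close to \<open>T u\<close> and \<open>\<mu>\<close> large the rank-one operator
  \<open>S = \<mu> \<phi>(\<cdot>) y\<close> satisfies \<open>\<parallel>T - S\<parallel> \<le> \<parallel>S\<parallel> - \<parallel>y\<parallel> + \<epsilon>\<close>. By separability of \<open>X\<close> countably many \<open>u\<close> and \<open>y\<close>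
  suffice, and the radii are bounded because \<open>\<mu>\<close> depends only on the modulus of exposedness, which in
  \<open>L\<^sub>p\<close> is uniform over the sphere: \<open>\<phi>\<close> is integration against \<open>sgn u \<bar>u\<bar>\<^sup>p\<^sup>-\<^sup>1\<close>, and the gap in Young's
  inequality controls \<open>\<bar>x - u\<bar>\<^sup>p\<close> pointwise. The spaces \<open>\<ell>\<^sub>p\<close> and \<open>L\<^sub>p[0,1]\<close> are treated together as \<open>L\<^sub>p\<close> of a
  measure.
\<close>

subsection \<open>Norming functionals in \<open>L\<^sub>p\<close>\<close>

definition signed_powr :: "real \<Rightarrow> real \<Rightarrow> real" where
  "signed_powr r s = sgn s * \<bar>s\<bar> powr r"

lemma borel_measurable_signed_powr [measurable]: "signed_powr r \<in> borel_measurable borel"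
  unfolding signed_powr_def[abs_def] by measurable

lemma continuous_on_signed_powr:
  assumes "0 < r"
  shows "continuous_on A (signed_powr r)"
proof -
  \<comment> \<open>The jump of \<open>sgn\<close> at 0 disappears after splitting into positive and
    negative part, because \<open>0 powr r = 0\<close>.\<close>
  have "signed_powr r = (\<lambda>s. max s 0 powr r - max (- s) 0 powr r)"
    using assms by (auto simp: signed_powr_def fun_eq_iff sgn_if max_def)
  moreover have "continuous_on A (\<lambda>s::real. max s 0 powr r - max (- s) 0 powr r)"
    using assms by (intro continuous_intros continuous_on_powr') auto
  ultimately show ?thesis by simp
qed

text \<open>Strict convexity: by the mean value theorem the chord between u and 1 has slope p *
  z^(p-1) with z strictly between them, which is compared with the slope p at 1. The point u = 0 is
  kept apart from the differentiation.\<close>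

lemma powr_above_tangent:
  fixes p u :: real
  assumes p: "1 < p" and u: "0 \<le> u" "u \<noteq> 1"
  shows "1 + p * (u - 1) < u powr p"
proof -
  consider "u = 0" | "0 < u" "u < 1" | "1 < u" using u by linarith
  then show ?thesis
  proof cases
    case 1
    then show ?thesis using p by simp
  next
    case 2
    have "\<exists>z. u < z \<and> z < 1 \<and> 1 powr p - u powr p = (1 - u) * (p * z powr (p - 1))"
      using 2 by (intro MVT2) (auto intro!: derivative_eq_intros)
    then obtain z where z: "u < z" "z < 1" "1 - u powr p = (1 - u) * (p * z powr (p - 1))" by auto
    have "z powr (p - 1) < 1 powr (p - 1)" using z 2 p by (intro powr_less_mono2) auto
    then have "(1 - u) * (p * z powr (p - 1)) < (1 - u) * (p * 1)"
      using 2 p by (intro mult_strict_left_mono) auto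
    then show ?thesis using z by (simp add: algebra_simps)
  next
    case 3
    have "\<exists>z. 1 < z \<and> z < u \<and> u powr p - 1 powr p = (u - 1) * (p * z powr (p - 1))"
      using 3 by (intro MVT2) (auto intro!: derivative_eq_intros)
    then obtain z where z: "1 < z" "z < u" "u powr p - 1 = (u - 1) * (p * z powr (p - 1))" by auto
    have "1 powr (p - 1) < z powr (p - 1)" using z 3 p by (intro powr_less_mono2) auto
    then have "(u - 1) * (p * 1) < (u - 1) * (p * z powr (p - 1))"
      using 3 p by (intro mult_strict_left_mono) auto
    then show ?thesis using z by (simp add: algebra_simps)
  qed
qed

text \<open>With q = p / (p - 1) the middle term is (|s|^(p-1))^q / q, so this is the defect in
  Young's inequality for the product of t and the signed power of s.\<close>

definition young_gap :: "real \<Rightarrow> real \<Rightarrow> real \<Rightarrow> real" where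
  "young_gap p s t = \<bar>t\<bar> powr p / p + (1 - 1 / p) * \<bar>s\<bar> powr p - signed_powr (p - 1) s * t"

lemma young_gap_scale:
  assumes "0 < r"
  shows "young_gap p (r * s) (r * t) = r powr p * young_gap p s t"
proof -
  have "r powr (p - 1) * r = r powr p"
    using assms powr_add[of r "p - 1" 1] by simp
  then have "r powr p * X = r * (r powr (p - 1) * X)" for X
    by (metis mult.assoc mult.commute)
  then show ?thesis using assms
    by (simp add: young_gap_def signed_powr_def abs_mult powr_mult sgn_mult algebra_simps)
qed

text \<open>Factoring out |s|^p leaves s = 1 and u = t / s. For u \<ge> 0 the gap is then 1/p times
  the height of u^p above its tangent at 1; for u < 0 the term -u is already positive.\<close>

lemma young_gap_pos:
  assumes p: "1 < p" and "s \<noteq> t"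
  shows "0 < young_gap p s t"
proof -
  have tangent: "0 < \<bar>u\<bar> powr p / p + (1 - 1 / p) - u" if "u \<noteq> 1" for u
  proof (cases "0 \<le> u")
    case True
    have "u = (1 + p * (u - 1)) / p + (1 - 1 / p)" using p by (simp add: field_simps)
    also have "\<dots> < u powr p / p + (1 - 1 / p)"
      using powr_above_tangent[OF p True that] p by (intro add_strict_right_mono divide_strict_right_mono) auto
    finally show ?thesis using True by simp
  next
    case False
    have "0 \<le> \<bar>u\<bar> powr p / p" "0 < 1 - 1 / p" using p by auto
    then show ?thesis using False by linarith
  qed
  show ?thesis
  proof (cases "s = 0")
    case True
    then show ?thesis using assms by (simp add: young_gap_def signed_powr_def)
  next
    case False
    define u where "u = t / s"
    have t: "t = s * u" and u: "u \<noteq> 1" using False assms(2) by (auto simp: u_def)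
    \<comment> \<open>The scaling rule requires a positive factor, so only |s| is pulled out and
      \<open>sgn s\<close> stays in both arguments.\<close>
    have "young_gap p s t = young_gap p (\<bar>s\<bar> * sgn s) (\<bar>s\<bar> * (sgn s * u))"
      unfolding t by (simp add: abs_mult_sgn mult.assoc[symmetric])
    also have "\<dots> = \<bar>s\<bar> powr p * (\<bar>u\<bar> powr p / p + (1 - 1 / p) - u)"
      using False by (subst young_gap_scale) (auto simp: young_gap_def signed_powr_def sgn_if abs_mult)
    also have "\<dots> > 0" using False tangent[OF u] by simp
    finally show ?thesis .
  qed
qed

lemma young_gap_refl:
  assumes "1 < p"
  shows "young_gap p s s = 0"
proof -
  have "signed_powr (p - 1) s * s = \<bar>s\<bar> powr p"
    using powr_add[of "\<bar>s\<bar>" "p - 1" 1] by (auto simp: signed_powr_def sgn_if)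
  then show ?thesis using assms by (simp add: young_gap_def field_simps)
qed

lemma young_gap_nonneg: "1 < p \<Longrightarrow> 0 \<le> young_gap p s t"
  using young_gap_pos[of p s t] young_gap_refl[of p s] by (cases "s = t") auto

text \<open>Both sides are homogeneous of degree \<open>p\<close>, so it is enough to look at the compact unit circle.\<close>

lemma dist_powr_le_young_gap:
  fixes p \<eta> :: real
  assumes p: "1 < p" and \<eta>: "0 < \<eta>"
  obtains c where "0 < c"
    "\<And>s t. \<bar>t - s\<bar> powr p \<le> \<eta> * (\<bar>s\<bar> powr p + \<bar>t\<bar> powr p) + c * young_gap p s t"
proof -
  let ?far = "\<lambda>s t. \<eta> * (\<bar>s\<bar> powr p + \<bar>t\<bar> powr p) \<le> \<bar>t - s\<bar> powr p"
  \<comment> \<open>On the rest of the circle the \<eta>-term alone gives the bound.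
    \<open>A\<close> avoids the diagonal, so by compactness the gap has a positive minimum
    there.\<close>
  define A where "A = sphere (0::real \<times> real) 1 \<inter> {z. ?far (fst z) (snd z)}"
  have cont: "continuous_on UNIV (\<lambda>z::real\<times>real. \<bar>fst z\<bar> powr p)"
      "continuous_on UNIV (\<lambda>z::real\<times>real. \<bar>snd z\<bar> powr p)"
      "continuous_on UNIV (\<lambda>z::real\<times>real. \<bar>snd z - fst z\<bar> powr p)"
    using p by (intro continuous_on_powr' continuous_intros; auto)+
  have "continuous_on UNIV (\<lambda>z::real\<times>real. young_gap p (fst z) (snd z))"
    unfolding young_gap_def using p
    by (intro continuous_intros cont continuous_on_compose2[OF continuous_on_signed_powr[of _ UNIV]]) auto
  then have gap_cont: "continuous_on A (\<lambda>z. young_gap p (fst z) (snd z))"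
    by (rule continuous_on_subset) simp
  have "compact A"
    unfolding A_def
    by (intro compact_Int_closed compact_sphere closed_Collect_le continuous_intros cont)
  have unit: "\<bar>fst z\<bar> \<le> 1" "\<bar>snd z\<bar> \<le> 1" if "z \<in> A" for z
    using that norm_fst_le[of "fst z" "snd z"] norm_snd_le[of "snd z" "fst z"] by (auto simp: A_def)
  have diag: "fst z \<noteq> snd z" if "z \<in> A" for z
  proof
    assume eq: "fst z = snd z"
    then have "\<eta> * (\<bar>fst z\<bar> powr p + \<bar>fst z\<bar> powr p) \<le> 0" using that p by (auto simp: A_def)
    moreover have "0 \<le> \<bar>fst z\<bar> powr p" by simp
    ultimately have "\<bar>fst z\<bar> powr p = 0" using \<eta>
      by (smt (verit) mult_pos_pos)
    then have "z = 0" using eq by (simp add: prod_eq_iff)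
    then show False using that by (simp add: A_def)
  qed
  obtain m where m: "0 < m" "\<And>z. z \<in> A \<Longrightarrow> m \<le> young_gap p (fst z) (snd z)"
  proof (cases "A = {}")
    case True
    \<comment> \<open>\<open>A\<close> can be empty for large \<eta>; any positive m then
      serves.\<close>
    then show ?thesis using that[of 1] by auto
  next
    case False
    obtain z where "z \<in> A" "\<forall>w\<in>A. young_gap p (fst z) (snd z) \<le> young_gap p (fst w) (snd w)"
      using continuous_attains_inf[OF \<open>compact A\<close> False gap_cont] by blast
    then show ?thesis using that[of "young_gap p (fst z) (snd z)"] young_gap_pos[OF p diag] by auto
  qed
  \<comment> \<open>On the unit circle |t - s| \<le> 2, so \<open>c\<close> times a gap of at least
    m dominates the left-hand side.\<close>
  define c where "c = 2 powr p / m"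
  have c: "0 < c" using m by (simp add: c_def)
  have bound: "\<bar>t - s\<bar> powr p \<le> \<eta> * (\<bar>s\<bar> powr p + \<bar>t\<bar> powr p) + c * young_gap p s t" (is "?L s t \<le> ?R s t")
    for s t
  proof -
    have sphere: "?L s t \<le> ?R s t" if "norm (s, t) = 1" for s t
    proof (cases "?far s t")
      case True
      then have A: "(s, t) \<in> A" using that by (simp add: A_def)
      have "\<bar>t - s\<bar> powr p \<le> 2 powr p" using unit[OF A] p by (intro powr_mono2) auto
      also have "\<dots> = c * m" using m by (simp add: c_def)
      also have "\<dots> \<le> c * young_gap p s t" using m(2)[OF A] c by simp
      finally show ?thesis using \<eta> by (smt (verit) mult_nonneg_nonneg powr_ge_zero)
    next
      case False
      then show ?thesis using c young_gap_nonneg[OF p, of s t] by (smt (verit) mult_nonneg_nonneg)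
    qed
    show ?thesis
    proof (cases "(s, t) = 0")
      case True
      then show ?thesis by (simp add: young_gap_def zero_prod_def)
    next
      case False
      define r where "r = norm (s, t)"
      have r: "0 < r" using False by (simp add: r_def)
      have st: "s = r * (s / r)" "t = r * (t / r)" using r by auto
      have "norm ((1 / r) *\<^sub>R (s, t)) = 1" using r unfolding norm_scaleR by (simp add: r_def[symmetric])
      then have le: "?L (s / r) (t / r) \<le> ?R (s / r) (t / r)" by (intro sphere) simp
      have "?L s t = \<bar>r * (t / r - s / r)\<bar> powr p" using r by (simp add: right_diff_distrib)
      also have "\<dots> = r powr p * ?L (s / r) (t / r)" using r by (simp add: abs_mult powr_mult)
      also have "\<dots> \<le> r powr p * ?R (s / r) (t / r)" using le by (intro mult_left_mono) auto
      also have "\<dots> = \<eta> * (\<bar>r * (s / r)\<bar> powr p + \<bar>r * (t / r)\<bar> powr p)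
          + c * young_gap p (r * (s / r)) (r * (t / r))"
        unfolding young_gap_scale[OF r] abs_mult powr_mult
        using r by (simp only: abs_of_pos distrib_left mult.assoc mult.left_commute)
      also have "\<dots> = ?R s t" using r by simp
      finally show ?thesis .
    qed
  qed
  show ?thesis by (rule that[OF c bound])
qed

section \<open>Functions in L_p, their norm and the duality pairing\<close>

definition Lp_fun :: "real \<Rightarrow> 'a measure \<Rightarrow> ('a \<Rightarrow> real) \<Rightarrow> bool" where
  "Lp_fun p M f \<longleftrightarrow> f \<in> borel_measurable M \<and> integrable M (\<lambda>x. \<bar>f x\<bar> powr p)"

definition Lp_norm :: "real \<Rightarrow> 'a measure \<Rightarrow> ('a \<Rightarrow> real) \<Rightarrow> real" where
  "Lp_norm p M f = (LINT x|M. \<bar>f x\<bar> powr p) powr (1 / p)"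

text \<open>The signed power of f with exponent p - 1 is its image under the duality map: for a unit
  vector f this is the norm-one functional with value 1 at f. It is linear in g but in general not
  in f.\<close>

definition Lp_pairing :: "real \<Rightarrow> 'a measure \<Rightarrow> ('a \<Rightarrow> real) \<Rightarrow> ('a \<Rightarrow> real) \<Rightarrow> real" where
  "Lp_pairing p M f g = (LINT x|M. signed_powr (p - 1) (f x) * g x)"

lemma Lp_fun_cong_AE:
  assumes "f \<in> borel_measurable M" "g \<in> borel_measurable M" "AE x in M. f x = g x"
  shows "Lp_fun p M f \<longleftrightarrow> Lp_fun p M g"
proof -
  have "integrable M (\<lambda>x. \<bar>f x\<bar> powr p) \<longleftrightarrow> integrable M (\<lambda>x. \<bar>g x\<bar> powr p)"
    using assms by (intro integrable_cong_AE) auto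
  then show ?thesis using assms by (simp add: Lp_fun_def)
qed

lemma Lp_norm_cong_AE:
  assumes "f \<in> borel_measurable M" "g \<in> borel_measurable M" "AE x in M. f x = g x"
  shows "Lp_norm p M f = Lp_norm p M g"
  unfolding Lp_norm_def using assms
  by (intro arg_cong2[where f = "(powr)"] integral_cong_AE) auto

lemma Lp_pairing_cong_AE:
  assumes "f \<in> borel_measurable M" "g \<in> borel_measurable M" "h \<in> borel_measurable M"
    "AE x in M. g x = h x"
  shows "Lp_pairing p M f g = Lp_pairing p M f h"
  unfolding Lp_pairing_def using assms by (intro integral_cong_AE) auto

lemma Lp_norm_nonneg: "0 \<le> Lp_norm p M f"
  by (simp add: Lp_norm_def)

context
  fixes p :: real and M :: "'a measure"
  assumes p: "1 < p"
begin

lemma Lp_fun_dominated: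
  assumes f: "f \<in> borel_measurable M" and g: "Lp_fun p M g" and le: "AE x in M. \<bar>f x\<bar> \<le> \<bar>g x\<bar>"
  shows "Lp_fun p M f"
proof -
  have "integrable M (\<lambda>x. \<bar>f x\<bar> powr p)"
  proof (rule Bochner_Integration.integrable_bound)
    show "integrable M (\<lambda>x. \<bar>g x\<bar> powr p)" using g by (simp add: Lp_fun_def)
    show "AE x in M. norm (\<bar>f x\<bar> powr p) \<le> norm (\<bar>g x\<bar> powr p)"
      using le p by (auto intro!: powr_mono2 elim!: AE_mp)
  qed (use f in measurable)
  then show ?thesis using f by (simp add: Lp_fun_def)
qed

lemma Lp_fun_add:
  assumes f: "Lp_fun p M f" and g: "Lp_fun p M g"
  shows "Lp_fun p M (\<lambda>x. f x + g x)"
proof -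
  have [measurable]: "f \<in> borel_measurable M" "g \<in> borel_measurable M"
    using assms by (auto simp: Lp_fun_def)
  have pt: "\<bar>a + b\<bar> powr p \<le> 2 powr p * (\<bar>a\<bar> powr p + \<bar>b\<bar> powr p)" for a b :: real
  proof -
    have "\<bar>a + b\<bar> powr p \<le> (2 * max \<bar>a\<bar> \<bar>b\<bar>) powr p" using p by (intro powr_mono2) auto
    also have "\<dots> = 2 powr p * max \<bar>a\<bar> \<bar>b\<bar> powr p" by (simp add: powr_mult)
    also have "\<dots> \<le> 2 powr p * (\<bar>a\<bar> powr p + \<bar>b\<bar> powr p)"
      by (intro mult_left_mono) (auto simp: max_def)
    finally show ?thesis .
  qed
  have "integrable M (\<lambda>x. \<bar>f x + g x\<bar> powr p)"
  proof (rule Bochner_Integration.integrable_bound)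
    show "integrable M (\<lambda>x. 2 powr p * (\<bar>f x\<bar> powr p + \<bar>g x\<bar> powr p))"
      using f g by (simp add: Lp_fun_def)
    show "AE x in M. norm (\<bar>f x + g x\<bar> powr p) \<le> norm (2 powr p * (\<bar>f x\<bar> powr p + \<bar>g x\<bar> powr p))"
      using pt by (auto intro!: AE_I2)
  qed measurable
  then show ?thesis by (simp add: Lp_fun_def)
qed

lemma Lp_fun_scale:
  assumes "Lp_fun p M f"
  shows "Lp_fun p M (\<lambda>x. c * f x)"
  using assms by (auto simp: Lp_fun_def abs_mult powr_mult)

lemma Lp_norm_powr: "Lp_norm p M f powr p = (LINT x|M. \<bar>f x\<bar> powr p)"
  using p by (simp add: Lp_norm_def powr_powr)

lemma Lp_norm_scale: "Lp_norm p M (\<lambda>x. c * f x) = \<bar>c\<bar> * Lp_norm p M f"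
  using p by (simp add: Lp_norm_def abs_mult powr_mult powr_powr)

lemma Lp_norm_le_iff:
  assumes "0 \<le> r"
  shows "Lp_norm p M f \<le> r \<longleftrightarrow> (LINT x|M. \<bar>f x\<bar> powr p) \<le> r powr p"
proof (cases "Lp_norm p M f \<le> r")
  case True
  then show ?thesis using powr_mono2[of p "Lp_norm p M f" r] p Lp_norm_nonneg[of p M f]
    by (simp add: Lp_norm_powr)
next
  case False
  then show ?thesis using powr_less_mono2[of p r "Lp_norm p M f"] p assms
    by (simp add: Lp_norm_powr)
qed

text \<open>Young's inequality for (s, t) and for (s, -t) bounds the absolute value of the integrand
  by integrable p-th powers.\<close>

lemma integrable_pairing:
  assumes f: "Lp_fun p M f" and g: "Lp_fun p M g"
  shows "integrable M (\<lambda>x. signed_powr (p - 1) (f x) * g x)"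
proof (rule Bochner_Integration.integrable_bound)
  have [measurable]: "f \<in> borel_measurable M" "g \<in> borel_measurable M"
    using assms by (auto simp: Lp_fun_def)
  show "integrable M (\<lambda>x. \<bar>g x\<bar> powr p / p + (1 - 1 / p) * \<bar>f x\<bar> powr p)"
    using assms by (simp add: Lp_fun_def)
  have "\<bar>signed_powr (p - 1) s * t\<bar> \<le> \<bar>t\<bar> powr p / p + (1 - 1 / p) * \<bar>s\<bar> powr p" for s t
    using young_gap_nonneg[OF p, of s t] young_gap_nonneg[OF p, of s "- t"]
    by (simp add: young_gap_def abs_le_iff)
  then show "AE x in M. norm (signed_powr (p - 1) (f x) * g x)
      \<le> norm (\<bar>g x\<bar> powr p / p + (1 - 1 / p) * \<bar>f x\<bar> powr p)"
    by (intro AE_I2) (smt (verit) real_norm_def)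
  show "(\<lambda>x. signed_powr (p - 1) (f x) * g x) \<in> borel_measurable M" by measurable
qed

lemma Lp_pairing_add:
  assumes "Lp_fun p M f" "Lp_fun p M g" "Lp_fun p M h"
  shows "Lp_pairing p M f (\<lambda>x. g x + h x) = Lp_pairing p M f g + Lp_pairing p M f h"
  unfolding Lp_pairing_def using assms
  by (simp add: ring_distribs integrable_pairing)

lemma Lp_pairing_scale: "Lp_pairing p M f (\<lambda>x. c * g x) = c * Lp_pairing p M f g"
proof -
  have "signed_powr (p - 1) (f x) * (c * g x) = c * (signed_powr (p - 1) (f x) * g x)" for x
    by (rule mult.left_commute)
  then show ?thesis unfolding Lp_pairing_def by (simp only: integral_mult_right_zero)
qed

lemma Lp_pairing_self: "Lp_pairing p M f f = (LINT x|M. \<bar>f x\<bar> powr p)"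
proof -
  have "signed_powr (p - 1) s * s = \<bar>s\<bar> powr p" for s
    using powr_add[of "\<bar>s\<bar>" "p - 1" 1] by (auto simp: signed_powr_def sgn_if)
  then show ?thesis by (simp add: Lp_pairing_def)
qed

lemma
  assumes f: "Lp_fun p M f" and g: "Lp_fun p M g"
  shows integrable_young_gap: "integrable M (\<lambda>x. young_gap p (f x) (g x))"
    and integral_young_gap: "(LINT x|M. young_gap p (f x) (g x))
      = (LINT x|M. \<bar>g x\<bar> powr p) / p + (1 - 1 / p) * (LINT x|M. \<bar>f x\<bar> powr p) - Lp_pairing p M f g"
proof -
  have int: "integrable M (\<lambda>x. \<bar>g x\<bar> powr p / p)" "integrable M (\<lambda>x. (1 - 1 / p) * \<bar>f x\<bar> powr p)"
    using assms by (auto simp: Lp_fun_def intro!: integrable_mult_right integrable_divide)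
  note ints = int integrable_pairing[OF f g]
  show "integrable M (\<lambda>x. young_gap p (f x) (g x))"
    unfolding young_gap_def
    by (intro Bochner_Integration.integrable_add Bochner_Integration.integrable_diff ints)
  show "(LINT x|M. young_gap p (f x) (g x))
      = (LINT x|M. \<bar>g x\<bar> powr p) / p + (1 - 1 / p) * (LINT x|M. \<bar>f x\<bar> powr p) - Lp_pairing p M f g"
    unfolding young_gap_def Lp_pairing_def
    by (simp only: ints Bochner_Integration.integral_add Bochner_Integration.integral_diff
        Bochner_Integration.integrable_add integral_mult_right_zero integral_divide_zero)
qed

text \<open>The integrated gap is the weighted sum of the p-th powers of the norms minus the
  pairing, and the weights 1/p and 1 - 1/p add up to 1. A pairing close to 1 therefore forces a
  small integrated gap.\<close>

lemma young_gap_unit: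
  assumes f: "Lp_fun p M f" "Lp_norm p M f = 1" and g: "Lp_fun p M g" "Lp_norm p M g \<le> 1"
  shows "(LINT x|M. young_gap p (f x) (g x)) \<le> 1 - Lp_pairing p M f g"
proof -
  have "(LINT x|M. \<bar>f x\<bar> powr p) = 1" using Lp_norm_powr[of f] f by simp
  moreover have "(LINT x|M. \<bar>g x\<bar> powr p) \<le> 1" using Lp_norm_le_iff[of 1 g] g by simp
  ultimately show ?thesis
    using p unfolding integral_young_gap[OF f(1) g(1)] by (simp add: field_simps)
qed

text \<open>This is Hoelder's inequality for the norming functional: the gap is nonnegative, so the
  pairing is at most 1 on the unit ball. Homogeneity and the change from g to -g do the
  rest.\<close>

lemma Lp_pairing_le_norm:
  assumes f: "Lp_fun p M f" "Lp_norm p M f = 1" and g: "Lp_fun p M g"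
  shows "\<bar>Lp_pairing p M f g\<bar> \<le> Lp_norm p M g"
proof -
  have unit: "Lp_pairing p M f g \<le> 1" if "Lp_fun p M g" "Lp_norm p M g \<le> 1" for g
    using young_gap_unit[OF f that] young_gap_nonneg[OF p]
      Bochner_Integration.integral_nonneg[of M "\<lambda>x. young_gap p (f x) (g x)"]
    by (smt (verit, best))
  have le: "Lp_pairing p M f g \<le> Lp_norm p M g" if g: "Lp_fun p M g" for g
  proof (rule field_le_epsilon)
    fix e :: real assume e: "0 < e"
    \<comment> \<open>The added e keeps the divisor positive even if g has norm 0.\<close>
    let ?r = "Lp_norm p M g + e"
    have r: "0 < ?r" using e Lp_norm_nonneg[of p M g] by simp
    have "Lp_pairing p M f (\<lambda>x. (1 / ?r) * g x) \<le> 1"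
      using r e by (intro unit Lp_fun_scale g, unfold Lp_norm_scale) (simp add: field_simps)
    then show "Lp_pairing p M f g \<le> ?r" using r unfolding Lp_pairing_scale by (simp add: field_simps)
  qed
  show ?thesis
    using le[OF g] le[OF Lp_fun_scale[OF g, of "- 1"]] Lp_pairing_scale[of f "- 1" g] Lp_norm_scale[of "- 1" g]
    by simp
qed

text \<open>Minkowski's inequality follows by testing the sum against its own norming functional.\<close>

lemma Lp_norm_triangle:
  assumes f: "Lp_fun p M f" and g: "Lp_fun p M g"
  shows "Lp_norm p M (\<lambda>x. f x + g x) \<le> Lp_norm p M f + Lp_norm p M g"
proof -
  let ?h = "\<lambda>x. f x + g x"
  let ?n = "Lp_norm p M ?h"
  show ?thesis
  proof (cases "?n = 0")
    case True
    then show ?thesis using Lp_norm_nonneg[of p M] by (simp add: add_nonneg_nonneg)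
  next
    case False
    then have n: "0 < ?n" using Lp_norm_nonneg[of p M ?h] by simp
    define u where "u = (\<lambda>x. (1 / ?n) * ?h x)"
    have u: "Lp_fun p M u" unfolding u_def by (intro Lp_fun_scale Lp_fun_add f g)
    have u1: "Lp_norm p M u = 1" unfolding u_def Lp_norm_scale using n by simp
    have "?h = (\<lambda>x. ?n * u x)" using n by (auto simp: u_def)
    then have "Lp_pairing p M u ?h = ?n * Lp_pairing p M u u"
      using Lp_pairing_scale[of u ?n u] by simp
    also have "\<dots> = ?n" using Lp_norm_powr[of u] u1 by (simp add: Lp_pairing_self)
    finally have "?n = Lp_pairing p M u f + Lp_pairing p M u g"
      using Lp_pairing_add[OF u f g] by simp
    also have "\<dots> \<le> Lp_norm p M f + Lp_norm p M g"
      using Lp_pairing_le_norm[OF u u1 f] Lp_pairing_le_norm[OF u u1 g] by linarith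
    finally show ?thesis .
  qed
qed

text \<open>Dominated convergence for |h n - f|^p. It serves the density arguments below, hence a
  majorant of the differences and a single good index.\<close>

lemma Lp_tendsto_dominated:
  assumes h: "\<And>n. h n \<in> borel_measurable M" and f: "f \<in> borel_measurable M" and g: "Lp_fun p M g"
    and dom: "\<And>n. AE x in M. \<bar>h n x - f x\<bar> \<le> \<bar>g x\<bar>"
    and lim: "AE x in M. (\<lambda>n. h n x) \<longlonglongrightarrow> f x" and e: "0 < e"
  shows "\<exists>n. Lp_norm p M (\<lambda>x. h n x - f x) < e"
proof -
  note [measurable] = h f
  have "(\<lambda>n. LINT x|M. \<bar>h n x - f x\<bar> powr p) \<longlonglongrightarrow> (LINT x|M. 0)"
  proof (rule integral_dominated_convergence)
    show "integrable M (\<lambda>x. \<bar>g x\<bar> powr p)" using g by (simp add: Lp_fun_def)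
    show "AE x in M. (\<lambda>n. \<bar>h n x - f x\<bar> powr p) \<longlonglongrightarrow> 0"
      using lim
    proof (rule AE_mp, intro AE_I2 impI)
      fix x assume "(\<lambda>n. h n x) \<longlonglongrightarrow> f x"
      then have "(\<lambda>n. h n x - f x) \<longlonglongrightarrow> 0" by (simp add: LIM_zero)
      then have "(\<lambda>n. \<bar>h n x - f x\<bar>) \<longlonglongrightarrow> 0" by (rule tendsto_rabs_zero)
      then have "(\<lambda>n. \<bar>h n x - f x\<bar> powr p) \<longlonglongrightarrow> 0 powr p"
        using p by (intro tendsto_powr') auto
      then show "(\<lambda>n. \<bar>h n x - f x\<bar> powr p) \<longlonglongrightarrow> 0" by simp
    qed
    show "AE x in M. norm (\<bar>h n x - f x\<bar> powr p) \<le> \<bar>g x\<bar> powr p" for n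
      using dom[of n] p by (auto intro!: powr_mono2 elim!: AE_mp)
  qed measurable
  \<comment> \<open>Half of e leaves room for the weak inequality of
    \<open>Lp_norm_le_iff\<close>.\<close>
  then have "eventually (\<lambda>n. (LINT x|M. \<bar>h n x - f x\<bar> powr p) < (e / 2) powr p) sequentially"
    using e by (intro order_tendstoD) auto
  then obtain n where "(LINT x|M. \<bar>h n x - f x\<bar> powr p) < (e / 2) powr p"
    by (auto simp: eventually_sequentially)
  then have "Lp_norm p M (\<lambda>x. h n x - f x) \<le> e / 2"
    using e by (subst Lp_norm_le_iff) auto
  then show ?thesis using e by (intro exI[of _ n]) auto
qed

text \<open>The pointwise bound of \<open>dist_powr_le_young_gap\<close> is integrated, and
  \<open>young_gap_unit\<close> controls the gap term. The constant c there depends only on p and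
  \<eta>, so \<delta> is the same for all unit vectors f.\<close>

lemma Lp_uniformly_exposed:
  assumes \<eta>: "0 < \<eta>"
  obtains \<delta> where "0 < \<delta>"
    "\<And>f g. Lp_fun p M f \<Longrightarrow> Lp_fun p M g \<Longrightarrow> Lp_norm p M f = 1 \<Longrightarrow> Lp_norm p M g \<le> 1 \<Longrightarrow>
      1 - \<delta> \<le> Lp_pairing p M f g \<Longrightarrow> Lp_norm p M (\<lambda>x. g x - f x) \<le> \<eta>"
proof -
  \<comment> \<open>The two norms are at most 1, so the first term integrates to at most 2 *
    \<open>?e\<close>. The choice of \<delta> bounds the gap term by 2 * \<open>?e\<close> too, and
    the total is \<eta>^p.\<close>
  let ?e = "\<eta> powr p / 4"
  have e: "0 < ?e" using \<eta> by simp
  obtain c where c: "0 < c"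
    "\<And>s t. \<bar>t - s\<bar> powr p \<le> ?e * (\<bar>s\<bar> powr p + \<bar>t\<bar> powr p) + c * young_gap p s t"
    using dist_powr_le_young_gap[OF p e] by blast
  define \<delta> where "\<delta> = 2 * ?e / c"
  show ?thesis
  proof (rule that[of \<delta>])
    show "0 < \<delta>" using \<eta> c by (simp add: \<delta>_def)
    fix f g assume f: "Lp_fun p M f" and g: "Lp_fun p M g" and f1: "Lp_norm p M f = 1"
      and g1: "Lp_norm p M g \<le> 1" and J: "1 - \<delta> \<le> Lp_pairing p M f g"
    have d: "Lp_fun p M (\<lambda>x. g x - f x)"
      using Lp_fun_add[OF g Lp_fun_scale[OF f, of "- 1"]] by simp
    have int: "integrable M (\<lambda>x. \<bar>f x\<bar> powr p)" "integrable M (\<lambda>x. \<bar>g x\<bar> powr p)"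
      using f g by (auto simp: Lp_fun_def)
    have "(LINT x|M. \<bar>g x - f x\<bar> powr p)
        \<le> (LINT x|M. ?e * (\<bar>f x\<bar> powr p + \<bar>g x\<bar> powr p) + c * young_gap p (f x) (g x))"
      using int d c integrable_young_gap[OF f g] by (intro integral_mono) (auto simp: Lp_fun_def)
    also have "\<dots> = ?e * ((LINT x|M. \<bar>f x\<bar> powr p) + (LINT x|M. \<bar>g x\<bar> powr p))
        + c * (LINT x|M. young_gap p (f x) (g x))"
      using int integrable_young_gap[OF f g] by (simp del: times_divide_eq_left)
    also have "\<dots> \<le> ?e * (1 + 1) + c * \<delta>"
    proof (intro add_mono mult_left_mono)
      show "(LINT x|M. \<bar>f x\<bar> powr p) \<le> 1" using Lp_norm_powr[of f] f1 by simp
      show "(LINT x|M. \<bar>g x\<bar> powr p) \<le> 1" using Lp_norm_le_iff[of 1 g] g1 by simp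
      show "(LINT x|M. young_gap p (f x) (g x)) \<le> \<delta>" using young_gap_unit[OF f f1 g g1] J by simp
    qed (use c e in auto)
    also have "\<dots> = \<eta> powr p" using c by (simp add: \<delta>_def)
    finally show "Lp_norm p M (\<lambda>x. g x - f x) \<le> \<eta>" using \<eta> by (subst Lp_norm_le_iff) auto
  qed
qed

end

subsection \<open>Ball coverings of operator spaces\<close>

text \<open>The slice of the unit ball cut off by \<phi> \<ge> 1 - \<delta> lies within \<eta> of u.
  Both constants are parameters so that one \<delta> can be required to serve all unit
  vectors.\<close>

definition exposing :: "'a::real_vector nspace \<Rightarrow> real \<Rightarrow> real \<Rightarrow> 'a \<Rightarrow> ('a \<Rightarrow> real) \<Rightarrow> bool" where
  "exposing X \<delta> \<eta> u \<phi> \<longleftrightarrow>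
    (\<forall>x\<in>nscarrier X. \<forall>y\<in>nscarrier X. \<phi> (x + y) = \<phi> x + \<phi> y) \<and>
    (\<forall>c. \<forall>x\<in>nscarrier X. \<phi> (c *\<^sub>R x) = c * \<phi> x) \<and>
    (\<forall>x\<in>nscarrier X. \<bar>\<phi> x\<bar> \<le> nsnorm X x) \<and> \<phi> u = 1 \<and>
    (\<forall>x\<in>nscarrier X. nsnorm X x \<le> 1 \<longrightarrow> 1 - \<delta> \<le> \<phi> x \<longrightarrow> nsnorm X (x - u) \<le> \<eta>)"

text \<open>In \<open>uniformly_exposed\<close> the choice of \<delta> precedes u. This order gives
  one scaling factor for all rank-one centres and hence a common bound for the radii.\<close>

locale uniformly_exposed_space =
  fixes X :: "'a::real_vector nspace"
  assumes zero_closed: "0 \<in> nscarrier X"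
    and add_closed: "\<And>x y. x \<in> nscarrier X \<Longrightarrow> y \<in> nscarrier X \<Longrightarrow> x + y \<in> nscarrier X"
    and scale_closed: "\<And>c x. x \<in> nscarrier X \<Longrightarrow> c *\<^sub>R x \<in> nscarrier X"
    and norm_nonneg: "\<And>x. x \<in> nscarrier X \<Longrightarrow> 0 \<le> nsnorm X x"
    and norm_scale: "\<And>c x. x \<in> nscarrier X \<Longrightarrow> nsnorm X (c *\<^sub>R x) = \<bar>c\<bar> * nsnorm X x"
    and norm_triangle: "\<And>x y. x \<in> nscarrier X \<Longrightarrow> y \<in> nscarrier X \<Longrightarrow>
      nsnorm X (x + y) \<le> nsnorm X x + nsnorm X y"
    and separable: "\<exists>D. countable D \<and> D \<subseteq> nscarrier X \<and>
      (\<forall>x\<in>nscarrier X. \<forall>e>0. \<exists>d\<in>D. nsnorm X (d - x) < e)"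
    and uniformly_exposed: "\<And>\<eta>. 0 < \<eta> \<Longrightarrow> \<exists>\<delta>>0. \<forall>u\<in>nscarrier X. nsnorm X u = 1 \<longrightarrow>
      (\<exists>\<phi>. exposing X \<delta> \<eta> u \<phi>)"
begin

section \<open>Calculus of the norm and the operator norm\<close>

abbreviation op_norm :: "('a \<Rightarrow> 'a) \<Rightarrow> real" where
  "op_norm \<equiv> nsnorm (operator_space X)"

lemma uminus_closed: "x \<in> nscarrier X \<Longrightarrow> - x \<in> nscarrier X"
  using scale_closed[of x "- 1"] by simp

lemma diff_closed: "x \<in> nscarrier X \<Longrightarrow> y \<in> nscarrier X \<Longrightarrow> x - y \<in> nscarrier X"
  using add_closed[of x "- y"] uminus_closed[of y] by simp

lemma norm_uminus: "x \<in> nscarrier X \<Longrightarrow> nsnorm X (- x) = nsnorm X x"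
  using norm_scale[of x "- 1"] by simp

lemma norm_zero: "nsnorm X 0 = 0"
  using norm_scale[OF zero_closed, of 0] by simp

lemma norm_diff_commute:
  "x \<in> nscarrier X \<Longrightarrow> y \<in> nscarrier X \<Longrightarrow> nsnorm X (x - y) = nsnorm X (y - x)"
  using norm_uminus[OF diff_closed[of x y]] by simp

lemma norm_diff_triangle:
  "x \<in> nscarrier X \<Longrightarrow> y \<in> nscarrier X \<Longrightarrow> z \<in> nscarrier X \<Longrightarrow>
    nsnorm X (x - z) \<le> nsnorm X (x - y) + nsnorm X (y - z)"
  using norm_triangle[OF diff_closed[of x y] diff_closed[of y z]] by simp

lemma norm_diff_le: "x \<in> nscarrier X \<Longrightarrow> y \<in> nscarrier X \<Longrightarrow> nsnorm X (x - y) \<le> nsnorm X x + nsnorm X y"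
  using norm_triangle[of x "- y"] uminus_closed[of y] norm_uminus[of y] by simp

lemma norm_le_add_diff: "x \<in> nscarrier X \<Longrightarrow> y \<in> nscarrier X \<Longrightarrow> nsnorm X x \<le> nsnorm X y + nsnorm X (x - y)"
  using norm_triangle[of y "x - y"] diff_closed[of x y] by simp

lemma
  assumes "T \<in> bounded_operators X" "x \<in> nscarrier X"
  shows operator_closed: "T x \<in> nscarrier X"
    and operator_scale: "T (c *\<^sub>R x) = c *\<^sub>R T x"
  using assms by (auto simp: bounded_operators_def)

lemma operator_add:
  "T \<in> bounded_operators X \<Longrightarrow> x \<in> nscarrier X \<Longrightarrow> y \<in> nscarrier X \<Longrightarrow> T (x + y) = T x + T y"
  unfolding bounded_operators_def by blast

lemma operator_diff:
  assumes T: "T \<in> bounded_operators X" and "x \<in> nscarrier X" "y \<in> nscarrier X"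
  shows "T (x - y) = T x - T y"
proof -
  have "T (x + (- 1) *\<^sub>R y) = T x + (- 1) *\<^sub>R T y"
    using assms scale_closed[of y "- 1"] operator_scale[OF T assms(3), of "- 1"]
      operator_add[OF T assms(2) scale_closed[OF assms(3), of "- 1"]] by simp
  then show ?thesis by simp
qed

lemma op_norm_upper:
  assumes T: "T \<in> bounded_operators X" and x: "x \<in> nscarrier X" "nsnorm X x \<le> 1"
  shows "nsnorm X (T x) \<le> op_norm T"
proof -
  obtain K where K: "\<And>x. x \<in> nscarrier X \<Longrightarrow> nsnorm X (T x) \<le> K * nsnorm X x"
    using T unfolding bounded_operators_def by blast
  \<comment> \<open>This makes the supremum one over a bounded set. The constant K carries no sign,
    hence \<bar>K\<bar>.\<close>
  have "nsnorm X (T y) \<le> \<bar>K\<bar>" if "y \<in> nscarrier X" "nsnorm X y \<le> 1" for y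
  proof -
    have "K * nsnorm X y \<le> \<bar>K\<bar> * 1"
      using that norm_nonneg by (intro mult_mono) auto
    then show ?thesis using K[OF that(1)] by simp
  qed
  then have "bdd_above ((\<lambda>x. nsnorm X (T x)) ` {x \<in> nscarrier X. nsnorm X x \<le> 1})"
    by (auto simp: bdd_above_def)
  then show ?thesis using x by (auto simp: operator_space_def intro!: cSUP_upper)
qed

text \<open>Stated for an arbitrary function T, so that it applies directly to differences such as
  \<open>T - S\<close>. The vector 0 makes the supremum one over a nonempty set.\<close>

lemma op_norm_least:
  assumes "\<And>x. x \<in> nscarrier X \<Longrightarrow> nsnorm X x \<le> 1 \<Longrightarrow> nsnorm X (T x) \<le> B"
  shows "op_norm T \<le> B"
proof -
  have "0 \<in> {x \<in> nscarrier X. nsnorm X x \<le> 1}" by (simp add: zero_closed norm_zero)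
  then show ?thesis using assms by (auto simp: operator_space_def intro!: cSUP_least)
qed

lemma op_norm_bound:
  assumes T: "T \<in> bounded_operators X" and x: "x \<in> nscarrier X"
  shows "nsnorm X (T x) \<le> op_norm T * nsnorm X x"
proof (cases "nsnorm X x = 0")
  case True
  then show ?thesis using T x by (auto simp: bounded_operators_def)
next
  case False
  then have n: "0 < nsnorm X x" using norm_nonneg[OF x] by simp
  let ?u = "(1 / nsnorm X x) *\<^sub>R x"
  have "nsnorm X (T ?u) \<le> op_norm T"
    using n by (intro op_norm_upper T scale_closed x) (simp add: norm_scale x)
  then show ?thesis
    using n by (simp add: operator_scale[OF T x] norm_scale operator_closed[OF T x] field_simps)
qed

text \<open>A near-maximizer y in the unit ball has positive norm, since a \<ge> 0 excludes T y of
  norm 0. Normalizing it can only increase the norm of its image.\<close>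

lemma op_norm_attained:
  assumes T: "T \<in> bounded_operators X" and a: "0 \<le> a" "a < op_norm T"
  obtains x where "x \<in> nscarrier X" "nsnorm X x = 1" "a < nsnorm X (T x)"
proof -
  obtain y where y: "y \<in> nscarrier X" "nsnorm X y \<le> 1" "a < nsnorm X (T y)"
    using op_norm_least[of T a] a by force
  have y0: "0 < nsnorm X y"
    using op_norm_bound[OF T y(1)] y a norm_nonneg[OF y(1)] by (cases "nsnorm X y = 0") auto
  let ?x = "(1 / nsnorm X y) *\<^sub>R y"
  have "nsnorm X (T y) \<le> nsnorm X (T ?x)"
    using y y0 norm_nonneg[OF operator_closed[OF T y(1)]]
    by (simp add: operator_scale[OF T] norm_scale operator_closed[OF T] field_simps mult_left_le_one_le)
  then show ?thesis using y y0 by (intro that[of ?x]) (auto simp: scale_closed norm_scale)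
qed

section \<open>Rank-one centres and the covering by balls\<close>

text \<open>
  Since \<open>\<phi>\<close> exposes \<open>u\<close>, the operator \<open>S = \<mu> \<phi>(\<cdot>) y\<close> comes close to its norm only near \<open>\<plusminus>u\<close>, where
  \<open>T\<close> is close to \<open>\<plusminus>y\<close>. Hence subtracting \<open>T\<close> lowers the norm of \<open>S\<close> by almost \<open>\<parallel>y\<parallel>\<close>.
\<close>

lemma op_norm_diff_rank_one:
  assumes T: "T \<in> bounded_operators X" "op_norm T \<le> 1"
    and u: "u \<in> nscarrier X" and y: "y \<in> nscarrier X" "nsnorm X (y - T u) \<le> \<eta>"
    and \<phi>_scale: "\<And>c x. x \<in> nscarrier X \<Longrightarrow> \<phi> (c *\<^sub>R x) = c * \<phi> x"
    and \<phi>_le: "\<And>x. x \<in> nscarrier X \<Longrightarrow> \<bar>\<phi> x\<bar> \<le> nsnorm X x"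
    and exposes: "\<And>x. x \<in> nscarrier X \<Longrightarrow> nsnorm X x \<le> 1 \<Longrightarrow> 1 - \<delta> \<le> \<phi> x \<Longrightarrow> nsnorm X (x - u) \<le> \<eta>"
    and \<eta>: "0 \<le> \<eta>" and \<delta>: "0 < \<delta>" "\<delta> \<le> 1 / 2" and \<mu>: "3 / \<delta> \<le> \<mu>" and half: "1 / 2 \<le> nsnorm X y"
    and S: "\<And>x. x \<in> nscarrier X \<Longrightarrow> S x = (\<mu> * \<phi> x) *\<^sub>R y"
  shows "op_norm (T - S) \<le> (\<mu> - 1) * nsnorm X y + 2 * \<eta>"
proof (rule op_norm_least)
  let ?B = "(\<mu> - 1) * nsnorm X y + 2 * \<eta>"
  fix x assume x: "x \<in> nscarrier X" "nsnorm X x \<le> 1"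
  have \<mu>\<delta>: "3 \<le> \<mu> * \<delta>" using \<mu> \<delta> by (simp add: field_simps)
  have "6 \<le> 3 / \<delta>" using \<delta> by (simp add: field_simps)
  then have \<mu>6: "6 \<le> \<mu>" using \<mu> by linarith
  \<comment> \<open>T x - S x is split as (T x - y) + (1 - \<mu> \<phi>(x)) y. In the slice around u
    the first part has norm at most 2 * \<eta>, and \<mu> \<phi>(x) lies between 3 and
    \<mu>.\<close>
  have near: "nsnorm X ((T - S) x) \<le> ?B"
    if x: "x \<in> nscarrier X" "nsnorm X x \<le> 1" and c: "1 - \<delta> \<le> \<phi> x" for x
  proof -
    note [simp] = x(1) u y(1) operator_closed[OF T(1)] scale_closed diff_closed
    have "nsnorm X (T x - T u) \<le> op_norm T * nsnorm X (x - u)"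
      using op_norm_bound[OF T(1), of "x - u"] by (simp add: operator_diff[OF T(1)])
    also have "\<dots> \<le> 1 * \<eta>"
      using exposes[OF x c] T(2) \<eta> norm_nonneg[of "x - u"] by (intro mult_mono) auto
    finally have "nsnorm X (T x - y) \<le> 2 * \<eta>"
      using norm_diff_triangle[of "T x" "T u" y] y(2) norm_diff_commute[of "T u" y] by simp
    moreover have "nsnorm X (y - (\<mu> * \<phi> x) *\<^sub>R y) = \<bar>1 - \<mu> * \<phi> x\<bar> * nsnorm X y"
      using norm_scale[of y "1 - \<mu> * \<phi> x"] by (simp add: scaleR_diff_left)
    moreover have "\<bar>1 - \<mu> * \<phi> x\<bar> \<le> \<mu> - 1"
    proof -
      have "1 / 2 \<le> \<phi> x" "\<phi> x \<le> 1" using c \<delta> \<phi>_le[OF x(1)] x(2) by auto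
      then have "\<mu> * (1 / 2) \<le> \<mu> * \<phi> x" "\<mu> * \<phi> x \<le> \<mu> * 1" using \<mu>6 by (auto intro!: mult_left_mono)
      then show ?thesis using \<mu>6 unfolding abs_le_iff by linarith
    qed
    then have "\<bar>1 - \<mu> * \<phi> x\<bar> * nsnorm X y \<le> (\<mu> - 1) * nsnorm X y"
      using half by (intro mult_right_mono) auto
    ultimately show ?thesis
      using norm_diff_triangle[of "T x" y "(\<mu> * \<phi> x) *\<^sub>R y"] by (simp add: S)
  qed
  show "nsnorm X ((T - S) x) \<le> ?B"
  proof -
    note [simp] = x(1) u y(1) operator_closed[OF T(1)] scale_closed diff_closed
    \<comment> \<open>The slice around -u reduces to the one around u by passing from x to -x;
      between the two slices S is well below its norm.\<close>
    consider "1 - \<delta> \<le> \<phi> x" | "1 - \<delta> \<le> - \<phi> x" | "\<bar>\<phi> x\<bar> \<le> 1 - \<delta>" by linarith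
    then show ?thesis
    proof cases
      case 1
      then show ?thesis using near x by simp
    next
      case 2
      have "(T - S) (- x) = - (T - S) x"
        using S[OF x(1)] S[OF uminus_closed[OF x(1)]] \<phi>_scale[OF x(1), of "- 1"]
          operator_scale[OF T(1) x(1), of "- 1"] by simp
      then have "nsnorm X ((T - S) x) = nsnorm X ((T - S) (- x))"
        using norm_uminus[of "(T - S) x"] by (simp add: S)
      also have "\<dots> \<le> ?B"
        using 2 x \<phi>_scale[OF x(1), of "- 1"] by (intro near) (auto simp: uminus_closed norm_uminus)
      finally show ?thesis .
    next
      case 3
      \<comment> \<open>Here the triangle inequality suffices: \<mu> * \<delta> \<ge> 3 saves (\<mu>
        * \<delta> - 1) times the norm of y, at least 2 * (1/2) = 1, which pays for T x.\<close>
      have "nsnorm X (T x) \<le> 1" using op_norm_upper[OF T(1) x] T(2) by simp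
      moreover have "nsnorm X ((\<mu> * \<phi> x) *\<^sub>R y) \<le> (\<mu> * (1 - \<delta>)) * nsnorm X y"
        using 3 \<mu>6 half by (auto simp: norm_scale abs_mult intro!: mult_mono)
      moreover have "(\<mu> * \<delta>) * nsnorm X y \<ge> 3 * nsnorm X y"
        using \<mu>\<delta> half by (intro mult_right_mono) auto
      ultimately have "nsnorm X (T x) + nsnorm X ((\<mu> * \<phi> x) *\<^sub>R y) \<le> (\<mu> - 1) * nsnorm X y"
        using half unfolding right_diff_distrib left_diff_distrib by linarith
      then show ?thesis
        using norm_diff_le[of "T x" "(\<mu> * \<phi> x) *\<^sub>R y"] \<eta> by (simp add: S)
    qed
  qed
qed

text \<open>The centres are the operators \<mu> \<phi>(\<cdot>) y with \<phi> exposing u, where u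
  and y run through countable dense sets of unit vectors and vectors; T is caught by a centre whose
  u nearly attains the norm of T and whose y is close to T u.\<close>

lemma operator_space_ball_cover:
  assumes \<alpha>: "0 < \<alpha>" "\<alpha> < 1"
  obtains r :: real and C :: "(('a \<Rightarrow> 'a) \<times> real) set" where "0 < r" "countable C"
    "\<And>S s. (S, s) \<in> C \<Longrightarrow> S \<in> nscarrier (operator_space X) \<and> 0 < s \<and> s + \<alpha> \<le> op_norm S \<and> s \<le> r"
    "nsphere (operator_space X) \<subseteq> (\<Union>(S, s)\<in>C. nsball (operator_space X) S s)"
proof -
  \<comment> \<open>Near-attainment costs \<eta>, replacing the vector by u costs 2 * \<eta>,
    replacing T u by y costs \<eta>, and the rank-one estimate costs 2 * \<eta>. The total stays
    below 8 * \<eta> = 1 - \<alpha>, and the norm of y stays above 1 - 4 * \<eta> \<ge> 1/2.\<close>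
  define \<eta> where "\<eta> = (1 - \<alpha>) / 8"
  have \<eta>_eq: "\<alpha> = 1 - 8 * \<eta>" by (simp add: \<eta>_def field_simps)
  have \<eta>: "0 < \<eta>" "\<eta> \<le> 1 / 8" using \<alpha> by (auto simp: \<eta>_def)
  obtain \<delta>0 \<phi> where \<delta>0: "0 < \<delta>0"
    and exposing: "\<And>u. u \<in> nscarrier X \<Longrightarrow> nsnorm X u = 1 \<Longrightarrow> exposing X \<delta>0 \<eta> u (\<phi> u)"
    using uniformly_exposed[OF \<eta>(1)] by metis
  note \<phi> = exposing[unfolded exposing_def]
  define \<delta> where "\<delta> = min \<delta>0 (1 / 2)"
  have \<delta>: "0 < \<delta>" "\<delta> \<le> 1 / 2" "\<delta> \<le> \<delta>0" using \<delta>0 by (auto simp: \<delta>_def)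
  define \<mu> where "\<mu> = 3 / \<delta>"
  have \<mu>: "0 < \<mu>" using \<delta> by (simp add: \<mu>_def)
  \<comment> \<open>The value 0 outside the carrier is the convention of
    \<open>bounded_operators\<close>.\<close>
  define S where "S u y = (\<lambda>x. if x \<in> nscarrier X then (\<mu> * \<phi> u x) *\<^sub>R y else 0)" for u y :: 'a
  obtain D where D: "countable D" "D \<subseteq> nscarrier X"
    "\<And>x e. x \<in> nscarrier X \<Longrightarrow> 0 < e \<Longrightarrow> \<exists>d\<in>D. nsnorm X (d - x) < e"
    using separable by metis
  \<comment> \<open>If d has norm 0, then division by zero yields the vector 0, which the condition
    on the norm discards.\<close>
  define U where "U = {u \<in> (\<lambda>d. (1 / nsnorm X d) *\<^sub>R d) ` D. nsnorm X u = 1}"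
  have U: "countable U" "\<And>u. u \<in> U \<Longrightarrow> u \<in> nscarrier X" "\<And>u. u \<in> U \<Longrightarrow> nsnorm X u = 1"
    using D by (auto simp: U_def intro: scale_closed countable_subset[of _ "(\<lambda>d. (1 / nsnorm X d) *\<^sub>R d) ` D"])
  have S_apply: "S u y x = (\<mu> * \<phi> u x) *\<^sub>R y" if "x \<in> nscarrier X" for u y x
    using that by (simp add: S_def)
  have S_norm: "nsnorm X (S u y x) \<le> \<mu> * nsnorm X y * nsnorm X x"
    if "u \<in> U" "y \<in> nscarrier X" "x \<in> nscarrier X" for u y x
  proof -
    have "\<mu> * nsnorm X y * \<bar>\<phi> u x\<bar> \<le> \<mu> * nsnorm X y * nsnorm X x"
      using \<phi>[OF U(2,3)[OF that(1)]] that \<mu> norm_nonneg[of y] by (intro mult_left_mono) auto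
    then show ?thesis using that \<mu> by (simp add: S_apply norm_scale abs_mult ac_simps)
  qed
  have S_op: "S u y \<in> bounded_operators X" if "u \<in> U" "y \<in> nscarrier X" for u y
  proof -
    have "\<exists>K. \<forall>x\<in>nscarrier X. nsnorm X (S u y x) \<le> K * nsnorm X x"
      using S_norm[OF that] by blast
    then show ?thesis
      using \<phi>[OF U(2,3)[OF that(1)]] that(2) unfolding bounded_operators_def
      by (auto simp: S_def add_closed scale_closed algebra_simps scaleR_left_distrib)
  qed
  \<comment> \<open>Each radius is the largest that \<alpha> permits. The bound 2 on the norm of y
    keeps all radii below 2 * \<mu>.\<close>
  define C where "C = {(S', s). S' \<in> (\<lambda>(u, y). S u y) ` (U \<times> {y \<in> D. nsnorm X y \<le> 2}) \<and>
      s = op_norm S' - \<alpha> \<and> 0 < s}"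
  show ?thesis
  proof (rule that[of "\<mu> * 2" C])
    show "0 < \<mu> * 2" using \<mu> by simp
    have "C \<subseteq> (\<lambda>S'. (S', op_norm S' - \<alpha>)) ` (\<lambda>(u, y). S u y) ` (U \<times> {y \<in> D. nsnorm X y \<le> 2})"
      by (auto simp: C_def)
    moreover have "countable ((\<lambda>S'. (S', op_norm S' - \<alpha>)) ` (\<lambda>(u, y). S u y) ` (U \<times> {y \<in> D. nsnorm X y \<le> 2}))"
      using U(1) D(1) by (intro countable_image countable_SIGMA) auto
    ultimately show "countable C" by (rule countable_subset)
  next
    fix S' s assume C: "(S', s) \<in> C"
    then obtain u y where uy: "u \<in> U" "y \<in> nscarrier X" "nsnorm X y \<le> 2" "S' = S u y"
      and s: "s = op_norm S' - \<alpha>" "0 < s"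
      using D(2) by (auto simp: C_def)
    have "op_norm S' \<le> \<mu> * 2"
    proof (rule op_norm_least)
      fix x assume x: "x \<in> nscarrier X" "nsnorm X x \<le> 1"
      have "\<mu> * nsnorm X y * nsnorm X x \<le> \<mu> * 2 * 1"
        using uy x \<mu> norm_nonneg[of x] norm_nonneg[of y] by (intro mult_mono) auto
      then show "nsnorm X (S' x) \<le> \<mu> * 2" using S_norm[OF uy(1,2) x(1)] uy by simp
    qed
    then show "S' \<in> nscarrier (operator_space X) \<and> 0 < s \<and> s + \<alpha> \<le> op_norm S' \<and> s \<le> \<mu> * 2"
      using s \<alpha> S_op[OF uy(1,2)] uy by (auto simp: operator_space_def)
  next
    show "nsphere (operator_space X) \<subseteq> (\<Union>(S, s)\<in>C. nsball (operator_space X) S s)"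
    proof
      fix T assume "T \<in> nsphere (operator_space X)"
      then have T: "T \<in> bounded_operators X" "op_norm T = 1"
        by (auto simp: nsphere_def operator_space_def)
      obtain v where v: "v \<in> nscarrier X" "nsnorm X v = 1" "1 - \<eta> < nsnorm X (T v)"
        using op_norm_attained[OF T(1), of "1 - \<eta>"] \<eta> T by auto
      obtain d where d: "d \<in> D" "nsnorm X (d - v) < \<eta>" using D(3)[OF v(1) \<eta>(1)] by blast
      have dX: "d \<in> nscarrier X" using d D by auto
      have n: "\<bar>nsnorm X d - 1\<bar> < \<eta>"
        using norm_le_add_diff[OF dX v(1)] norm_le_add_diff[OF v(1) dX] d(2) v(2)
          norm_diff_commute[OF dX v(1)] by (simp add: abs_less_iff)
      then have n0: "0 < nsnorm X d" using \<eta> by linarith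
      define u where "u = (1 / nsnorm X d) *\<^sub>R d"
      have uU: "u \<in> U" using d(1) n0 dX by (auto simp: U_def u_def norm_scale)
      note u = U(2,3)[OF uU]
      \<comment> \<open>Normalizing d moves it by the deviation of its norm from 1, which is less
        than \<eta>.\<close>
      have "u - d = (1 / nsnorm X d - 1) *\<^sub>R d" by (simp add: u_def scaleR_diff_left)
      then have "nsnorm X (u - d) = \<bar>1 / nsnorm X d - 1\<bar> * \<bar>nsnorm X d\<bar>" using dX n0 by (simp add: norm_scale)
      also have "\<dots> = \<bar>1 - nsnorm X d\<bar>" unfolding abs_mult[symmetric] using n0 by (simp add: left_diff_distrib)
      finally have "nsnorm X (u - v) < 2 * \<eta>"
        using norm_diff_triangle[OF u(1) dX v(1)] n d(2) by linarith
      then have "nsnorm X (T v - T u) < 2 * \<eta>"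
        using op_norm_bound[OF T(1) diff_closed[OF v(1) u(1)]] T(2) norm_diff_commute[OF u(1) v(1)]
        by (simp add: operator_diff[OF T(1) v(1) u(1)])
      then have Tu: "1 - 3 * \<eta> < nsnorm X (T u)"
        using norm_le_add_diff[OF operator_closed[OF T(1) v(1)] operator_closed[OF T(1) u(1)]] v(3) by simp
      have Tu1: "nsnorm X (T u) \<le> 1" using op_norm_upper[OF T(1) u(1)] u T by simp
      obtain y where y: "y \<in> D" "nsnorm X (y - T u) < \<eta>"
        using D(3)[OF operator_closed[OF T(1) u(1)] \<eta>(1)] by blast
      have yX: "y \<in> nscarrier X" using y D by auto
      have y_lower: "1 - 4 * \<eta> < nsnorm X y"
        using norm_le_add_diff[OF operator_closed[OF T(1) u(1)] yX] y(2) Tu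
          norm_diff_commute[OF yX operator_closed[OF T(1) u(1)]] by simp
      have y_upper: "nsnorm X y \<le> 2"
        using norm_le_add_diff[OF yX operator_closed[OF T(1) u(1)]] y(2) Tu1 \<eta> by simp
      have "op_norm (T - S u y) \<le> (\<mu> - 1) * nsnorm X y + 2 * \<eta>"
      proof (rule op_norm_diff_rank_one[where u = u and \<phi> = "\<phi> u" and \<delta> = \<delta>])
        show "nsnorm X (x - u) \<le> \<eta>" if "x \<in> nscarrier X" "nsnorm X x \<le> 1" "1 - \<delta> \<le> \<phi> u x" for x
          using \<phi>[OF u] that \<delta> by auto
      qed (use T u yX y \<phi>[OF u] \<eta> \<delta> y_lower in \<open>auto simp: S_apply \<mu>_def\<close>)
      \<comment> \<open>The norm of S is tested at u, where \<phi> takes the value 1.\<close>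
      moreover have S_lower: "\<mu> * nsnorm X y \<le> op_norm (S u y)"
        using op_norm_upper[OF S_op[OF uU yX] u(1)] u \<phi>[OF u] yX \<mu> by (simp add: S_apply norm_scale)
      ultimately have gap: "op_norm (T - S u y) < op_norm (S u y) - \<alpha>"
        using y_lower \<eta>(1) \<eta>_eq unfolding left_diff_distrib by linarith
      \<comment> \<open>With \<mu> \<ge> 6 the norm of S is at least 3, so the radius is
        positive.\<close>
      have "6 * (1 / 2) \<le> \<mu> * nsnorm X y"
        using \<delta> \<eta> y_lower by (intro mult_mono) (auto simp: \<mu>_def field_simps)
      then have "0 < op_norm (S u y) - \<alpha>" using S_lower \<alpha> by linarith
      then have "(S u y, op_norm (S u y) - \<alpha>) \<in> C" using gap uU y y_upper by (auto simp: C_def)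
      moreover have "T \<in> nsball (operator_space X) (S u y) (op_norm (S u y) - \<alpha>)"
        using T gap by (simp add: nsball_def) (simp add: operator_space_def)
      ultimately show "T \<in> (\<Union>(S, s)\<in>C. nsball (operator_space X) S s)" by blast
    qed
  qed
qed

section \<open>The UBCP and the ball-covering index\<close>

lemma operator_space_UBCP: "UBCP (operator_space X)"
proof -
  obtain r :: real and C :: "(('a \<Rightarrow> 'a) \<times> real) set" where C: "0 < r" "countable C"
    "\<And>S s. (S, s) \<in> C \<Longrightarrow> S \<in> nscarrier (operator_space X) \<and> 0 < s \<and> s + 1 / 2 \<le> op_norm S \<and> s \<le> r"
    "nsphere (operator_space X) \<subseteq> (\<Union>(S, s)\<in>C. nsball (operator_space X) S s)"
    using operator_space_ball_cover[of "1 / 2"] by auto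
  show ?thesis
    unfolding UBCP_def
    by (rule exI[of _ r], rule conjI[OF C(1)], rule exI[of _ "1 / 2"], rule conjI, simp, rule exI[of _ C])
      (use C in auto)
qed

lemma operator_space_BCP:
  assumes "0 < \<alpha>" "\<alpha> < 1"
  shows "BCP \<alpha> (operator_space X)"
proof -
  obtain r :: real and C :: "(('a \<Rightarrow> 'a) \<times> real) set" where C: "0 < r" "countable C"
    "\<And>S s. (S, s) \<in> C \<Longrightarrow> S \<in> nscarrier (operator_space X) \<and> 0 < s \<and> s + \<alpha> \<le> op_norm S \<and> s \<le> r"
    "nsphere (operator_space X) \<subseteq> (\<Union>(S, s)\<in>C. nsball (operator_space X) S s)"
    using operator_space_ball_cover[OF assms] by metis
  show ?thesis
    unfolding BCP_def by (rule exI[of _ C]) (use C in auto)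
qed

text \<open>The set in the definition of \<open>bc\<close> contains every \<alpha> between 0 and 1
  and is bounded by 1.\<close>

lemma bc_operator_space: "bc (operator_space X) = 1"
proof -
  let ?A = "{\<alpha> \<in> {-1..<1}. BCP \<alpha> (operator_space X)}"
  have mem: "\<alpha> \<in> ?A" if "0 < \<alpha>" "\<alpha> < 1" for \<alpha>
    using operator_space_BCP[OF that] that by auto
  have ne: "\<exists>\<alpha>\<in>{-1..<1}. BCP \<alpha> (operator_space X)" using mem[of "1 / 2"] by auto
  have "Sup ?A = 1"
  proof (rule cSup_eq_non_empty)
    show "?A \<noteq> {}" using ne by auto
    fix b assume b: "\<And>\<alpha>. \<alpha> \<in> ?A \<Longrightarrow> \<alpha> \<le> b"
    show "1 \<le> b"
    proof (rule dense_le_bounded[of "0::real"])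
      show "\<alpha> \<le> b" if "0 < \<alpha>" "\<alpha> < 1" for \<alpha> using b[OF mem[OF that]] .
    qed simp
  qed auto
  then show ?thesis using ne by (simp add: bc_def)
qed

end

subsection \<open>The spaces \<open>\<ell>\<^sub>p\<close> and \<open>L\<^sub>p[0,1]\<close>\<close>

text \<open>\<open>R\<close> picks a representative of every vector, e.g. of a class modulo equality almost everywhere.\<close>

locale Lp_model =
  fixes p :: real and M :: "'b measure" and X :: "'a::real_vector nspace"
    and R :: "'a \<Rightarrow> 'b \<Rightarrow> real"
  assumes p: "1 < p"
    and R_measurable [measurable]: "\<And>x. R x \<in> borel_measurable M"
    and R_zero: "AE t in M. R 0 t = 0"
    and R_add: "\<And>x y. AE t in M. R (x + y) t = R x t + R y t"
    and R_scale: "\<And>c x. AE t in M. R (c *\<^sub>R x) t = c * R x t"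
    and carrier: "\<And>x. x \<in> nscarrier X \<longleftrightarrow> Lp_fun p M (R x)"
    and norm: "\<And>x. x \<in> nscarrier X \<Longrightarrow> nsnorm X x = Lp_norm p M (R x)"
    and model_separable: "\<exists>D. countable D \<and> D \<subseteq> nscarrier X \<and>
      (\<forall>x\<in>nscarrier X. \<forall>e>0. \<exists>d\<in>D. nsnorm X (d - x) < e)"
begin

lemma R_diff: "AE t in M. R (x - y) t = R x t - R y t"
proof -
  have "AE t in M. R (x + (- 1) *\<^sub>R y) t = R x t + R ((- 1) *\<^sub>R y) t" by (rule R_add)
  then show ?thesis using R_scale[of "- 1" y] by eventually_elim simp
qed

lemma model_add_closed:
  assumes "x \<in> nscarrier X" "y \<in> nscarrier X"
  shows "x + y \<in> nscarrier X"
  using Lp_fun_add[OF p] assms unfolding carrier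
  by (subst Lp_fun_cong_AE[OF _ _ R_add]) auto

lemma model_scale_closed:
  assumes "x \<in> nscarrier X"
  shows "c *\<^sub>R x \<in> nscarrier X"
  using Lp_fun_scale[OF p] assms unfolding carrier
  by (subst Lp_fun_cong_AE[OF _ _ R_scale]) auto

lemma model_norm_diff:
  assumes "x \<in> nscarrier X" "y \<in> nscarrier X"
  shows "nsnorm X (x - y) = Lp_norm p M (\<lambda>t. R x t - R y t)"
proof -
  have d: "x - y \<in> nscarrier X"
    using model_add_closed[OF assms(1) model_scale_closed[OF assms(2), of "- 1"]] by simp
  show ?thesis
    unfolding norm[OF d] by (intro Lp_norm_cong_AE R_diff) auto
qed

text \<open>The functional exposing u is the pairing with \<open>R u\<close>. The map
  \<open>R\<close> is linear only almost everywhere, so every identity passes through a congruence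
  lemma for functions equal almost everywhere.\<close>

sublocale uniformly_exposed_space X
proof
  show "0 \<in> nscarrier X"
    unfolding carrier using Lp_fun_cong_AE[OF _ _ R_zero, of p] p by (simp add: Lp_fun_def)
  show "x + y \<in> nscarrier X" if "x \<in> nscarrier X" "y \<in> nscarrier X" for x y
    using that by (rule model_add_closed)
  show scale: "c *\<^sub>R x \<in> nscarrier X" if "x \<in> nscarrier X" for c x
    using that by (rule model_scale_closed)
  show "0 \<le> nsnorm X x" if "x \<in> nscarrier X" for x
    using that by (simp add: norm Lp_norm_nonneg)
  show "nsnorm X (c *\<^sub>R x) = \<bar>c\<bar> * nsnorm X x" if "x \<in> nscarrier X" for c x
    using Lp_norm_cong_AE[OF _ _ R_scale[of c x], of p] Lp_norm_scale[OF p, of M c "R x"]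
    by (simp add: norm that scale)
  show "nsnorm X (x + y) \<le> nsnorm X x + nsnorm X y" if "x \<in> nscarrier X" "y \<in> nscarrier X" for x y
    using Lp_norm_cong_AE[OF _ _ R_add[of x y], of p] Lp_norm_triangle[OF p, of M "R x" "R y"] that
    by (simp add: norm model_add_closed) (simp add: carrier)
  show "\<exists>D. countable D \<and> D \<subseteq> nscarrier X \<and>
      (\<forall>x\<in>nscarrier X. \<forall>e>0. \<exists>d\<in>D. nsnorm X (d - x) < e)"
    by (rule model_separable)
next
  fix \<eta> :: real assume "0 < \<eta>"
  then obtain \<delta> where \<delta>: "0 < \<delta>"
    "\<And>f g. Lp_fun p M f \<Longrightarrow> Lp_fun p M g \<Longrightarrow> Lp_norm p M f = 1 \<Longrightarrow> Lp_norm p M g \<le> 1 \<Longrightarrow>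
      1 - \<delta> \<le> Lp_pairing p M f g \<Longrightarrow> Lp_norm p M (\<lambda>x. g x - f x) \<le> \<eta>"
    using Lp_uniformly_exposed[OF p, where M = M] by metis
  have "exposing X \<delta> \<eta> u (\<lambda>x. Lp_pairing p M (R u) (R x))"
    if u: "u \<in> nscarrier X" "nsnorm X u = 1" for u
    unfolding exposing_def
  proof (intro conjI ballI allI impI)
    have Ru: "Lp_fun p M (R u)" "Lp_norm p M (R u) = 1" using u by (auto simp: carrier norm)
    show "Lp_pairing p M (R u) (R (x + y)) = Lp_pairing p M (R u) (R x) + Lp_pairing p M (R u) (R y)"
      if "x \<in> nscarrier X" "y \<in> nscarrier X" for x y
      using Lp_pairing_add[OF p Ru(1), of "R x" "R y"] that
      by (subst Lp_pairing_cong_AE[OF _ _ _ R_add]) (auto simp: carrier)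
    show "Lp_pairing p M (R u) (R (c *\<^sub>R x)) = c * Lp_pairing p M (R u) (R x)" for c x
      using Lp_pairing_scale[OF p, of M "R u" c "R x"]
      by (subst Lp_pairing_cong_AE[OF _ _ _ R_scale]) auto
    show "\<bar>Lp_pairing p M (R u) (R x)\<bar> \<le> nsnorm X x" if "x \<in> nscarrier X" for x
      using Lp_pairing_le_norm[OF p Ru] that by (auto simp: carrier norm)
    show "Lp_pairing p M (R u) (R u) = 1"
      using Lp_pairing_self[OF p, of M "R u"] Lp_norm_powr[OF p, of M "R u"] Ru by simp
    show "nsnorm X (x - u) \<le> \<eta>"
      if "x \<in> nscarrier X" "nsnorm X x \<le> 1" "1 - \<delta> \<le> Lp_pairing p M (R u) (R x)" for x
      using \<delta>(2)[OF Ru(1) _ Ru(2), of "R x"] that by (simp add: model_norm_diff u(1)) (simp add: carrier norm)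
  qed
  then show "\<exists>\<delta>>0. \<forall>u\<in>nscarrier X. nsnorm X u = 1 \<longrightarrow> (\<exists>\<phi>. exposing X \<delta> \<eta> u \<phi>)"
    using \<delta>(1) by blast
qed

end

section \<open>Rational approximation and the separability of \<open>ell_p\<close>\<close>

text \<open>Rounding \<bar>s\<bar> down and keeping the sign gives an error of at most
  \<bar>s\<bar>, so a function dominates the error of its own approximation.\<close>

definition step_toward_zero :: "nat \<Rightarrow> real \<Rightarrow> real" where
  "step_toward_zero n s = sgn s * (real_of_int \<lfloor>real (Suc n) * \<bar>s\<bar>\<rfloor> / real (Suc n))"

lemma step_toward_zero_rat: "step_toward_zero n s \<in> \<rat>"
proof -
  have "sgn s \<in> \<rat>" by (auto simp: sgn_if)
  then show ?thesis unfolding step_toward_zero_def by (intro Rats_mult Rats_divide) auto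
qed

lemma step_toward_zero_dist:
  "\<bar>step_toward_zero n s - s\<bar> \<le> \<bar>s\<bar>" "\<bar>step_toward_zero n s - s\<bar> \<le> 1 / real (Suc n)"
proof -
  let ?q = "real_of_int \<lfloor>real (Suc n) * \<bar>s\<bar>\<rfloor> / real (Suc n)"
  have q: "0 \<le> ?q" "?q \<le> \<bar>s\<bar>" "\<bar>s\<bar> \<le> ?q + 1 / real (Suc n)"
  proof -
    show "0 \<le> ?q" by simp
    have "real_of_int \<lfloor>real (Suc n) * \<bar>s\<bar>\<rfloor> \<le> real (Suc n) * \<bar>s\<bar>" by (rule of_int_floor_le)
    then show "?q \<le> \<bar>s\<bar>" by (simp add: divide_le_eq mult.commute del: of_nat_Suc)
    have "real (Suc n) * \<bar>s\<bar> \<le> real_of_int \<lfloor>real (Suc n) * \<bar>s\<bar>\<rfloor> + 1" by linarith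
    then have "\<bar>s\<bar> \<le> (real_of_int \<lfloor>real (Suc n) * \<bar>s\<bar>\<rfloor> + 1) / real (Suc n)"
      by (simp add: le_divide_eq mult.commute del: of_nat_Suc)
    then show "\<bar>s\<bar> \<le> ?q + 1 / real (Suc n)" by (simp add: add_divide_distrib)
  qed
  have "\<bar>step_toward_zero n s - s\<bar> = \<bar>s\<bar> - ?q"
  proof (cases "s = 0")
    case True then show ?thesis by (simp add: step_toward_zero_def)
  next
    case False
    then have "step_toward_zero n s - s = - (sgn s * (\<bar>s\<bar> - ?q))"
      by (simp only: step_toward_zero_def right_diff_distrib sgn_mult_abs)
    then show ?thesis using False q(2) by (simp add: abs_mult abs_sgn_eq del: of_nat_Suc)
  qed
  then show "\<bar>step_toward_zero n s - s\<bar> \<le> \<bar>s\<bar>" "\<bar>step_toward_zero n s - s\<bar> \<le> 1 / real (Suc n)"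
    using q by linarith+
qed

lemma tendsto_if_within_inverse_Suc:
  fixes a :: "nat \<Rightarrow> real"
  assumes b: "b \<longlonglongrightarrow> s" and le: "eventually (\<lambda>n. \<bar>a n - b n\<bar> \<le> 1 / real (Suc n)) sequentially"
  shows "a \<longlonglongrightarrow> s"
proof -
  have "(\<lambda>n. 1 / real (Suc n)) \<longlonglongrightarrow> 0" by (rule LIMSEQ_Suc[OF lim_1_over_n])
  then have "(\<lambda>n. a n - b n) \<longlonglongrightarrow> 0"
    by (rule Lim_null_comparison[rotated]) (use le in simp)
  then show ?thesis using tendsto_add[OF _ b] by fastforce
qed

lemma countable_Rats_lists: "countable {qs :: real list. set qs \<subseteq> \<rat>}"
  using countable_lists[OF countable_rat] by (simp add: lists_eq_set)

text \<open>Sequences are their own representatives over the counting measure. The dense set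
  consists of the finitely supported rational sequences, coded by lists.\<close>

lemma Lp_model_ell_p:
  assumes p: "1 < p"
  shows "Lp_model p (count_space UNIV) (ell_p p) (\<lambda>x. x)"
proof
  let ?M = "count_space (UNIV :: nat set)"
  let ?X = "ell_p p"
  show carrier: "x \<in> nscarrier ?X \<longleftrightarrow> Lp_fun p ?M x" for x
    by (simp add: ell_p_def Lp_fun_def integrable_count_space_nat_iff)
  show norm: "nsnorm ?X x = Lp_norm p ?M x" if "x \<in> nscarrier ?X" for x
    using that unfolding carrier
    by (simp add: ell_p_def Lp_norm_def Lp_fun_def integral_count_space_nat)
  let ?h = "\<lambda>qs i. if i < length qs then qs ! i else (0::real)"
  let ?D = "?h ` {qs. set qs \<subseteq> \<rat>}"
  have approx: "\<exists>d\<in>?D. Lp_fun p ?M d \<and> Lp_norm p ?M (\<lambda>i. d i - x i) < e"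
    if x: "Lp_fun p ?M x" and e: "0 < e" for x e
  proof -
    define h where "h n = (\<lambda>i. if i < n then step_toward_zero n (x i) else 0)" for n
    have dom: "\<bar>h n i - x i\<bar> \<le> \<bar>x i\<bar>" for n i
      using step_toward_zero_dist(1) by (simp add: h_def)
    have lim: "(\<lambda>n. h n i) \<longlonglongrightarrow> x i" for i
      \<comment> \<open>Coordinate i is cut off for n \<le> i and rounded from n =
        \<open>Suc i\<close> on.\<close>
      by (rule tendsto_if_within_inverse_Suc[OF tendsto_const], rule eventually_sequentiallyI[of "Suc i"])
        (use step_toward_zero_dist(2) in \<open>simp add: h_def\<close>)
    obtain n where n: "Lp_norm p ?M (\<lambda>i. h n i - x i) < e"
      using Lp_tendsto_dominated[OF p, of h ?M x x e] x dom lim e by auto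
    have hd: "h n = ?h (map (\<lambda>i. step_toward_zero n (x i)) [0..<n])"
      by (auto simp: h_def)
    have "h n \<in> ?D"
      unfolding hd by (rule imageI) (auto simp: step_toward_zero_rat)
    \<comment> \<open>Membership of \<open>h n\<close> follows from that of its difference to x,
      which x dominates.\<close>
    moreover have "Lp_fun p ?M (\<lambda>i. (h n i - x i) + x i)"
      using dom x by (intro Lp_fun_add[OF p] x Lp_fun_dominated[OF p _ x]) auto
    ultimately show ?thesis using n by auto
  qed
  show "\<exists>D. countable D \<and> D \<subseteq> nscarrier ?X \<and>
      (\<forall>x\<in>nscarrier ?X. \<forall>e>0. \<exists>d\<in>D. nsnorm ?X (d - x) < e)"
  proof (rule exI[of _ "?D \<inter> nscarrier ?X"], intro conjI ballI allI impI)
    show "countable (?D \<inter> nscarrier ?X)" using countable_Rats_lists by blast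
    fix x :: "nat \<Rightarrow> real" and e :: real assume x: "x \<in> nscarrier ?X" and e: "0 < e"
    obtain d where d: "d \<in> ?D" "Lp_fun p ?M d" "Lp_norm p ?M (\<lambda>i. d i - x i) < e"
      using approx[of x e] x e carrier by blast
    have "Lp_fun p ?M (\<lambda>i. d i + (- 1) * x i)"
      using x d carrier by (intro Lp_fun_add[OF p] Lp_fun_scale[OF p]) auto
    then have "d - x \<in> nscarrier ?X" unfolding carrier by (simp add: fun_diff_def)
    then have "nsnorm ?X (d - x) < e" using d by (simp add: norm fun_diff_def)
    then show "\<exists>d\<in>?D \<inter> nscarrier ?X. nsnorm ?X (d - x) < e" using d carrier by blast
  qed simp
qed (use p in \<open>auto simp: scaleR_fun_def\<close>)

section \<open>Step functions and the separability of \<open>Lp01\<close>\<close>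

text \<open>For t \<ge> 0 and n > 0 this is the step function with value \<open>qs ! i\<close> on
  [i/n, (i+1)/n) and 0 beyond the list. Coding by lists makes those with rational values
  countable.\<close>

definition list_step :: "nat \<Rightarrow> real list \<Rightarrow> real \<Rightarrow> real" where
  "list_step n qs t = (let i = nat \<lfloor>real n * t\<rfloor> in if i < length qs then qs ! i else 0)"

lemma borel_measurable_list_step [measurable]: "list_step n qs \<in> borel_measurable borel"
proof -
  have "(\<lambda>t::real. nat \<lfloor>real n * t\<rfloor>) \<in> borel \<rightarrow>\<^sub>M count_space UNIV" by measurable
  moreover have "(\<lambda>i. if i < length qs then qs ! i else 0) \<in> count_space UNIV \<rightarrow>\<^sub>M borel" by simp
  ultimately show ?thesis unfolding list_step_def[abs_def] Let_def by (rule measurable_compose)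
qed

text \<open>By uniform continuity a fine mesh costs less than e/2, and rounding the values at the
  mesh points to rationals costs less than e/2.\<close>

lemma list_step_dense_continuous:
  fixes f :: "real \<Rightarrow> real"
  assumes f: "continuous_on {0..1} f" and e: "0 < e"
  shows "\<exists>n qs. set qs \<subseteq> \<rat> \<and> (\<forall>t\<in>{0..1}. \<bar>list_step n qs t - f t\<bar> \<le> e)"
proof -
  have "uniformly_continuous_on {0..1} f"
    using f by (intro compact_uniformly_continuous) auto
  then obtain d where d: "0 < d" "\<And>s t. s \<in> {0..1} \<Longrightarrow> t \<in> {0..1} \<Longrightarrow> \<bar>s - t\<bar> < d \<Longrightarrow> \<bar>f s - f t\<bar> < e / 2"
    using e unfolding uniformly_continuous_on_def dist_real_def by (metis half_gt_zero)
  obtain n where n: "1 / real (Suc n) < d" using nat_approx_posE[OF d(1)] by (metis of_nat_Suc)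
  obtain m where m: "1 / real (Suc m) < e / 2" using nat_approx_posE[of "e / 2"] e by (metis half_gt_zero of_nat_Suc)
  \<comment> \<open>The list has n + 2 entries because t = 1 has index n + 1.\<close>
  define qs where "qs = map (\<lambda>i. step_toward_zero m (f (real i / real (Suc n)))) [0..<Suc (Suc n)]"
  show ?thesis
  proof (intro exI conjI ballI)
    show "set qs \<subseteq> \<rat>" by (auto simp: qs_def step_toward_zero_rat)
    fix t :: real assume t: "t \<in> {0..1}"
    define i where "i = nat \<lfloor>real (Suc n) * t\<rfloor>"
    have "0 \<le> real (Suc n) * t" "real (Suc n) * t \<le> real (Suc n) * 1"
      using t by (auto intro!: mult_left_mono simp del: of_nat_Suc)
    then have i: "real i \<le> real (Suc n) * t" "real (Suc n) * t < real i + 1"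
      unfolding i_def by linarith+
    have i_le: "i \<le> Suc n"
      using order_trans[OF i(1), of "real (Suc n)"] \<open>real (Suc n) * t \<le> real (Suc n) * 1\<close>
      by (simp only: mult_1_right of_nat_le_iff)
    have t': "real i / real (Suc n) \<in> {0..1}" using i_le by simp
    have "\<bar>real i / real (Suc n) - t\<bar> = t - real i / real (Suc n)"
      using i(1) by (simp add: abs_if divide_less_eq mult.commute del: of_nat_Suc)
    also have "\<dots> \<le> 1 / real (Suc n)"
    proof -
      have "t \<le> (real i + 1) / real (Suc n)"
        using i(2) by (simp add: le_divide_eq mult.commute del: of_nat_Suc)
      then show ?thesis by (simp add: add_divide_distrib)
    qed
    finally have "\<bar>f (real i / real (Suc n)) - f t\<bar> < e / 2" using d(2)[OF t' t] n by simp
    moreover have "list_step (Suc n) qs t = step_toward_zero m (f (real i / real (Suc n)))"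
      using i_le unfolding list_step_def i_def[symmetric] Let_def qs_def
      by (simp del: upt_Suc of_nat_Suc)
    ultimately show "\<bar>list_step (Suc n) qs t - f t\<bar> \<le> e"
      using step_toward_zero_dist(2)[of m "f (real i / real (Suc n))"] m by linarith
  qed
qed

text \<open>A measurable function is an almost everywhere limit of continuous ones, and these are
  replaced by rational step functions with error 1 / (n + 1). The uniform bound prepares dominated
  convergence.\<close>

lemma list_step_AE_approx:
  assumes f: "f \<in> borel_measurable (lebesgue_on {0..1})" and bound: "\<And>t. \<bar>f t\<bar> \<le> k"
  obtains h :: "nat \<Rightarrow> real \<Rightarrow> real" where
    "\<And>n. \<exists>m qs. set qs \<subseteq> \<rat> \<and> h n = list_step m qs"
    "\<And>n t. t \<in> {0..1} \<Longrightarrow> \<bar>h n t\<bar> \<le> k + 1"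
    "AE t in lebesgue_on {0..1}. (\<lambda>n. h n t) \<longlonglongrightarrow> f t"
proof -
  have k: "0 \<le> k" using bound[of 0] by linarith
  have "(\<lambda>t. if t \<in> {0..1} then f t else 0) \<in> borel_measurable lebesgue"
    using f by (subst borel_measurable_if) auto
  then have "(\<lambda>t. if t \<in> {0..1} then f t else 0) measurable_on {0..1}"
    by (rule lebesgue_measurable_imp_measurable_on) simp
  then obtain N g where N: "negligible N" and g: "\<And>n::nat. continuous_on UNIV (g n)"
    and lim: "\<And>t. t \<notin> N \<Longrightarrow> (\<lambda>n. g n t) \<longlonglongrightarrow> (if t \<in> {0..1} then f t else 0)"
    unfolding measurable_on_def by fastforce
  \<comment> \<open>Clipping keeps continuity, imposes the bound k, and does not change the limit
    since \<bar>f t\<bar> \<le> k.\<close>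
  define g' where "g' n t = max (- k) (min k (g n t))" for n t
  have "\<exists>h. (\<exists>m qs. set qs \<subseteq> \<rat> \<and> h = list_step m qs) \<and> (\<forall>t\<in>{0..1}. \<bar>h t - g' n t\<bar> \<le> 1 / real (Suc n))" for n
  proof -
    have "continuous_on {0..1} (g' n)"
      unfolding g'_def by (intro continuous_intros continuous_on_subset[OF g]) auto
    from list_step_dense_continuous[OF this, of "1 / real (Suc n)"] show ?thesis by fastforce
  qed
  then obtain h where h: "\<And>n. \<exists>m qs. set qs \<subseteq> \<rat> \<and> h n = list_step m qs"
    "\<And>n t. t \<in> {0..1} \<Longrightarrow> \<bar>h n t - g' n t\<bar> \<le> 1 / real (Suc n)"
    by metis
  show ?thesis
  proof (rule that[OF h(1)])
    show "\<bar>h n t\<bar> \<le> k + 1" if "t \<in> {0..1}" for n t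
    proof -
      have "\<bar>g' n t\<bar> \<le> k" using k by (auto simp: g'_def)
      moreover have "1 / real (Suc n) \<le> 1" by simp
      ultimately show ?thesis using h(2)[OF that, of n] by linarith
    qed
    have "AE t in lebesgue_on {0..1}. t \<notin> N"
      using N by (auto simp: AE_restrict_space_iff negligible_iff_null_sets intro: AE_not_in AE_mp)
    moreover have "AE t in lebesgue_on {0..1}. t \<in> {0..1::real}"
      by (rule AE_I2) (simp add: space_restrict_space)
    ultimately show "AE t in lebesgue_on {0..1}. (\<lambda>n. h n t) \<longlonglongrightarrow> f t"
    proof eventually_elim
      fix t :: real assume t: "t \<notin> N" "t \<in> {0..1}"
      have "(\<lambda>n. g' n t) \<longlonglongrightarrow> max (- k) (min k (f t))"
        unfolding g'_def using lim[OF t(1)] t(2) by (intro tendsto_intros) auto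
      then have "(\<lambda>n. g' n t) \<longlonglongrightarrow> f t" using bound[of t] by (simp add: abs_le_iff min_absorb2 max_absorb2)
      then show "(\<lambda>n. h n t) \<longlonglongrightarrow> f t"
        by (rule tendsto_if_within_inverse_Suc) (use h(2)[OF t(2)] in simp)
    qed
  qed
qed

text \<open>Truncation at height k costs e/2, with f itself as majorant. The bounded truncation is
  then approximated by step functions with a constant majorant, which is integrable on
  [0,1].\<close>

lemma list_step_dense_Lp:
  assumes p: "1 < p" and f: "Lp_fun p (lebesgue_on {0..1}) f" and e: "0 < e"
  obtains m qs where "set qs \<subseteq> \<rat>" "Lp_norm p (lebesgue_on {0..1}) (\<lambda>t. list_step m qs t - f t) < e"
proof -
  let ?M = "lebesgue_on {0..1::real}"
  have [measurable]: "f \<in> borel_measurable ?M" using f by (simp add: Lp_fun_def)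
  have [measurable]: "list_step m qs \<in> borel_measurable ?M" for m qs
    by (rule measurable_restrict_space1, rule measurable_completion) simp
  define trunc where "trunc k t = max (- real k) (min (real k) (f t))" for k t
  have trunc_meas [measurable]: "trunc k \<in> borel_measurable ?M" for k
    unfolding trunc_def[abs_def] by measurable
  have "\<bar>trunc k t - f t\<bar> \<le> \<bar>f t\<bar>" for k t by (auto simp: trunc_def)
  moreover have "(\<lambda>k. trunc k t) \<longlonglongrightarrow> f t" for t
  proof (rule tendsto_eventually, rule eventually_sequentiallyI)
    fix k assume "nat \<lceil>\<bar>f t\<bar>\<rceil> \<le> k"
    then have "\<bar>f t\<bar> \<le> real k" by linarith
    then show "trunc k t = f t" by (auto simp: trunc_def)
  qed
  ultimately obtain k where k: "Lp_norm p ?M (\<lambda>t. trunc k t - f t) < e / 2"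
    using Lp_tendsto_dominated[OF p, of trunc ?M f f "e / 2"] f e by auto
  obtain h where h: "\<And>n. \<exists>m qs. set qs \<subseteq> \<rat> \<and> h n = list_step m qs"
    "\<And>n t. t \<in> {0..1} \<Longrightarrow> \<bar>h n t\<bar> \<le> real k + 1"
    "AE t in ?M. (\<lambda>n. h n t) \<longlonglongrightarrow> trunc k t"
    by (rule list_step_AE_approx[OF trunc_meas[of k], of "real k"]) (auto simp: trunc_def[of k])
  have h_meas [measurable]: "h n \<in> borel_measurable ?M" for n using h(1)[of n] by auto
  have finite_measure: "finite_measure ?M" by (intro finite_measure_lebesgue_on) simp
  \<comment> \<open>The step functions are bounded by k + 1 and the truncation by k.\<close>
  have const: "Lp_fun p ?M (\<lambda>_. 2 * real k + 1)"
    using finite_measure.integrable_const[OF finite_measure] by (simp add: Lp_fun_def)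
  have dom: "\<bar>h n t - trunc k t\<bar> \<le> \<bar>2 * real k + 1\<bar>" if "t \<in> {0..1}" for n t
    using h(2)[OF that, of n] by (auto simp: trunc_def)
  have AE_dom: "AE t in ?M. \<bar>h n t - trunc k t\<bar> \<le> \<bar>2 * real k + 1\<bar>" for n
    using dom by (intro AE_I2) (simp add: space_restrict_space)
  obtain n where n: "Lp_norm p ?M (\<lambda>t. h n t - trunc k t) < e / 2"
    using Lp_tendsto_dominated[OF p h_meas trunc_meas const AE_dom h(3), of "e / 2"] e by auto
  have fin: "Lp_fun p ?M (\<lambda>t. h n t - trunc k t)"
    using AE_dom by (intro Lp_fun_dominated[OF p _ const]) auto
  have "Lp_fun p ?M (\<lambda>t. trunc k t - f t)"
    by (rule Lp_fun_dominated[OF p _ f]) (auto simp: trunc_def)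
  then have "Lp_norm p ?M (\<lambda>t. (h n t - trunc k t) + (trunc k t - f t))
      \<le> Lp_norm p ?M (\<lambda>t. h n t - trunc k t) + Lp_norm p ?M (\<lambda>t. trunc k t - f t)"
    by (rule Lp_norm_triangle[OF p fin])
  then have "Lp_norm p ?M (\<lambda>t. h n t - f t) < e" using n k by simp
  then show ?thesis using h(1)[of n] that by auto
qed

lemma Lp_fun_list_step:
  assumes p: "1 < p"
  shows "Lp_fun p (lebesgue_on {0..1}) (list_step m qs)"
proof -
  let ?M = "lebesgue_on {0..1::real}"
  have finite_measure: "finite_measure ?M" by (intro finite_measure_lebesgue_on) simp
  \<comment> \<open>This sum bounds every entry as well as the default value 0.\<close>
  have "\<bar>list_step m qs t\<bar> \<le> \<bar>sum_list (map abs qs)\<bar>" for t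
  proof (cases "nat \<lfloor>real m * t\<rfloor> < length qs")
    case True
    then have "\<bar>list_step m qs t\<bar> \<in> set (map abs qs)"
      by (simp add: list_step_def Let_def)
    then have "\<bar>list_step m qs t\<bar> \<le> sum_list (map abs qs)"
      by (rule member_le_sum_list) auto
    then show ?thesis by simp
  qed (simp add: list_step_def Let_def)
  moreover have "Lp_fun p ?M (\<lambda>_. sum_list (map abs qs))"
    using finite_measure.integrable_const[OF finite_measure] by (simp add: Lp_fun_def)
  moreover have "list_step m qs \<in> borel_measurable ?M"
    by (rule measurable_restrict_space1, rule measurable_completion) simp
  ultimately show ?thesis using Lp_fun_dominated[OF p] by blast
qed

section \<open>Representatives of the classes in \<open>L0\<close>\<close>

lemma ae_eq01_rep_L0: "ae_eq01 (rep_L0 x) (rep_L0 x)"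
  by (rule Quotient3_rep_reflp[OF Quotient3_L0])

lemma abs_rep_L0: "abs_L0 (rep_L0 x) = x"
  by (rule Quotient3_abs_rep[OF Quotient3_L0])

text \<open>The representative chosen by the quotient need not be f itself. This lemma turns each
  operation on \<open>L0\<close> into an identity almost everywhere.\<close>

lemma AE_rep_L0:
  assumes "x = abs_L0 f" "f \<in> borel_measurable (lebesgue_on {0..1})"
  shows "AE t in lebesgue_on {0..1}. rep_L0 x t = f t"
proof -
  have "ae_eq01 (rep_L0 (abs_L0 f)) f"
    by (rule rep_abs_rsp_left[OF Quotient3_L0]) (simp add: assms(2) ae_eq01_def)
  then show ?thesis using assms(1) by (simp add: ae_eq01_def)
qed

text \<open>The dense set consists of the classes of step functions with rational values; the other
  requirements are properties of \<open>rep_L0\<close>.\<close>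

lemma Lp_model_Lp01:
  assumes p: "1 < p"
  shows "Lp_model p (lebesgue_on {0..1}) (Lp01 p) rep_L0"
proof
  let ?M = "lebesgue_on {0..1::real}"
  let ?X = "Lp01 p"
  show meas [measurable]: "rep_L0 x \<in> borel_measurable ?M" for x
    using ae_eq01_rep_L0[of x] by (simp add: ae_eq01_def)
  show "AE t in ?M. rep_L0 0 t = 0"
    by (rule AE_rep_L0) (simp_all add: zero_L0_def)
  show "AE t in ?M. rep_L0 (x + y) t = rep_L0 x t + rep_L0 y t" for x y
    by (rule AE_rep_L0)
      (auto simp: plus_L0.abs_eq[OF ae_eq01_rep_L0 ae_eq01_rep_L0, symmetric] abs_rep_L0)
  have diff: "AE t in ?M. rep_L0 (x - y) t = rep_L0 x t - rep_L0 y t" for x y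
    by (rule AE_rep_L0)
      (auto simp: minus_L0.abs_eq[OF ae_eq01_rep_L0 ae_eq01_rep_L0, symmetric] abs_rep_L0)
  show "AE t in ?M. rep_L0 (c *\<^sub>R x) t = c * rep_L0 x t" for c x
    by (rule AE_rep_L0) (auto simp: scaleR_L0.abs_eq[OF ae_eq01_rep_L0, symmetric] abs_rep_L0)
  show carrier: "x \<in> nscarrier ?X \<longleftrightarrow> Lp_fun p ?M (rep_L0 x)" for x
    using p_integrable.abs_eq[OF ae_eq01_rep_L0, of p x] by (simp add: Lp01_def Lp_fun_def abs_rep_L0)
  have norm: "nsnorm ?X x = Lp_norm p ?M (rep_L0 x)" for x
    using p_norm.abs_eq[OF ae_eq01_rep_L0, of p x] by (simp add: Lp01_def Lp_norm_def abs_rep_L0)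
  then show "nsnorm ?X x = Lp_norm p ?M (rep_L0 x)" for x .
  let ?D = "(\<lambda>(m, qs). abs_L0 (list_step m qs)) ` (UNIV \<times> {qs. set qs \<subseteq> \<rat>})"
  have list_meas [measurable]: "list_step m qs \<in> borel_measurable ?M" for m qs
    using Lp_fun_list_step[OF p] by (simp add: Lp_fun_def)
  have rep: "AE t in ?M. rep_L0 (abs_L0 (list_step m qs)) t = list_step m qs t" for m qs
    by (rule AE_rep_L0) auto
  show "\<exists>D. countable D \<and> D \<subseteq> nscarrier ?X \<and>
      (\<forall>x\<in>nscarrier ?X. \<forall>e>0. \<exists>d\<in>D. nsnorm ?X (d - x) < e)"
  proof (rule exI[of _ ?D], intro conjI ballI allI impI)
    show "countable ?D" using countable_Rats_lists by (intro countable_image countable_SIGMA) auto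
    have "abs_L0 (list_step m qs) \<in> nscarrier ?X" for m qs
      unfolding carrier Lp_fun_cong_AE[OF meas list_meas rep] by (rule Lp_fun_list_step[OF p])
    then show "?D \<subseteq> nscarrier ?X" by auto
    fix x :: L0 and e :: real assume x: "x \<in> nscarrier ?X" and e: "0 < e"
    obtain m qs where qs: "set qs \<subseteq> \<rat>" "Lp_norm p ?M (\<lambda>t. list_step m qs t - rep_L0 x t) < e"
      by (rule list_step_dense_Lp[OF p x[unfolded carrier] e])
    have "AE t in ?M. rep_L0 (abs_L0 (list_step m qs) - x) t = list_step m qs t - rep_L0 x t"
      using rep diff[of "abs_L0 (list_step m qs)" x] by eventually_elim simp
    then have "nsnorm ?X (abs_L0 (list_step m qs) - x) < e"
      unfolding norm using qs(2) Lp_norm_cong_AE[of "rep_L0 (abs_L0 (list_step m qs) - x)" ?M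
          "\<lambda>t. list_step m qs t - rep_L0 x t" p] by simp
    moreover have "abs_L0 (list_step m qs) \<in> ?D" using qs(1) by (intro image_eqI[of _ _ "(m, qs)"]) auto
    ultimately show "\<exists>d\<in>?D. nsnorm ?X (d - x) < e" by blast
  qed
qed (rule p)

theorem corollary4p7:
  fixes p :: real
  assumes "1 < p"
  shows "UBCP (operator_space (ell_p p)) \<and> bc (operator_space (ell_p p)) = 1 \<and>
         UBCP (operator_space (Lp01 p)) \<and> bc (operator_space (Lp01 p)) = 1"
proof -
  interpret ell_p: Lp_model p "count_space UNIV" "ell_p p" "\<lambda>x. x"
    by (rule Lp_model_ell_p[OF assms])
  interpret Lp01: Lp_model p "lebesgue_on {0..1}" "Lp01 p" rep_L0
    by (rule Lp_model_Lp01[OF assms])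
  show ?thesis
    using ell_p.operator_space_UBCP ell_p.bc_operator_space
      Lp01.operator_space_UBCP Lp01.bc_operator_space by blast
qed

end
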